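(* Let $n\ge1$, let $\mathfrak p_0\in A=\mathbb F_q[T]$ be monic irreducible of degree $r$ with $\gcd(n,r)=1$, let $t\in\mathbb F_{q^r}$ be a root of $\mathfrak p_0$, and let $\phi$ be the Drinfeld module with $\phi_T=t+\tau^n$. Let $m\mid n$ and let $\mathfrak p\ne\mathfrak p_0$ be an arbitrary monic irreducible element of $A$, of degree $d$ (no coprimality between $m$ and $d$ is assumed). With the notation of the context, let $\alpha\in M=\phi[\mathfrak p]$ be $S$-normal, $1\le\delta\le m$, and let $C=\operatorname{Ann}(W_\delta)$ be the rank-BCH code of designed distance $\delta$. Then $A(C)\subseteq\operatorname{Mat}_{m\times nd}(\mathbb F_q)$ is an $\mathbb F_{q^m}$-linear MRD code: $$\dim_{\mathbb F_q}A(C)=nd\,(m-\delta+1),\qquad d_R(A(C))=\delta.$$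
   Context: $q$ is a prime power, $A=\mathbb F_q[T]$, $\overline{\mathbb F}_q$ a fixed algebraic closure, $[i]=q^i$, $\beta^{[i]}=\beta^{q^i}$. Twisted polynomials in $\tau$ satisfy $\tau a=a^q\tau$ and act on $\overline{\mathbb F}_q$ with $\tau$ acting as $x\mapsto x^q$ and constants by multiplication. $\phi\colon A\to\mathbb F_{q^r}\{\tau\}$, $a\mapsto\phi_a$, is the $\mathbb F_q$-algebra homomorphism with $\phi_T=t+\tau^n$. Put $\kappa=A/\mathfrak p\cong\mathbb F_{q^d}$ and $M=\phi[\mathfrak p]=\{v\in\overline{\mathbb F}_q:\phi_{\mathfrak p}(v)=0\}$, a $\kappa$-vector space of dimension $n$ via $a\cdot v=\phi_a(v)$; $E=\operatorname{End}_\kappa(M)$; $\pi=\tau^r$, acting on $M$ by $v\mapsto v^{[r]}$; $S=\kappa[\pi|_M]$; $R_0=\kappa[\pi^m|_M]$; $R=\operatorname{Cent}_E(R_0)$ (centralizer); $L=\mathbb F_{q^m}\subseteq R$ acting on $M$ by scalar multiplication. A code is a left ideal of $R$. For an $R_0$-submodule $W\subseteq M$, $\operatorname{Ann}(W)=\{f\in R: f(W)=0\}$. Matrix of $f$: multiplication $L\otimes_{\mathbb F_q}S\to R$ is bijective and $\dim_{\mathbb F_q}S=nd$. Fix $\mathbb F_q$-bases $\lambda_0,\dots,\lambda_{m-1}$ of $L$ and $s_1,\dots,s_{nd}$ of $S$. Every $f\in R$ is uniquely $f=\sum_jb_js_j$ with $b_j=\sum_ia_{ij}\lambda_i\in L$,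 $a_{ij}\in\mathbb F_q$; put $A_f=(a_{ij})\in\operatorname{Mat}_{m\times nd}(\mathbb F_q)$, and for a code $C$ put $A(C)=\{A_f:f\in C\}$. $\alpha\in M$ is $S$-normal if $\alpha,\alpha^{[r]},\dots,\alpha^{[r(n-1)]}$ is a $\kappa$-basis of $M$. For $S$-normal $\alpha$ and $1\le\delta\le m$, $W_\delta=\bigoplus_{i=0}^{\delta-2}R_0\,\alpha^{[ri]}\subseteq M$ (the sum is direct; $W_1=0$), and the rank-BCH code of designed distance $\delta$ is $\operatorname{Ann}(W_\delta)$. For a nonzero $\mathbb F_q$-linear $\mathcal C\subseteq\operatorname{Mat}_{a\times b}(\mathbb F_q)$, $d_R(\mathcal C)$ is the minimum rank of a nonzero element. If $a\le b$ and $d_R(\mathcal C)=\delta$, the Singleton bound is $\dim_{\mathbb F_q}\mathcal C\le b(a-\delta+1)$, and $\mathcal C$ is MRD if equality holds. $\mathbb F_{q^m}$-linear means: closed under left multiplication by all $M_\zeta$, $\zeta\in L$, where $M_\zeta\in\operatorname{Mat}_m(\mathbb F_q)$ is the matrix of multiplication by $\zeta$ on $L$ in the basis $(\lambda_i)$. *)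

theory Defs
  imports
    "HOL-Algebra.Algebraic_Closure_Type"
    "HOL-Algebra.Generated_Rings"
    "HOL-Library.Function_Algebras"
    "HOL-Library.Cardinality"
    "Jordan_Normal_Form.DL_Rank"
begin

text \<open>
  The field with \<open>q\<close> elements is an arbitrary finite field type \<open>'a\<close>, so \<open>q = CARD('a)\<close>; the ring
  \<open>A\<close> is \<open>'a poly\<close>; the fixed algebraic closure is \<open>'a alg_closure\<close>, with embedding \<open>to_ac\<close>.
\<close>

section \<open>Twisted polynomials and the Drinfeld module\<close>

definition frob :: "nat \<Rightarrow> 'a::finite_field alg_closure \<Rightarrow> 'a alg_closure" where
  "frob i x = x ^ (CARD('a) ^ i)"

text \<open>
  A twisted polynomial \<open>\<Sum>c\<^sub>i \<tau>\<^sup>i\<close> is stored as the ordinary polynomial with the coefficients \<open>c\<^sub>i\<close>.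
  Addition and multiplication by a constant from the left are those of ordinary polynomials; the
  product is the biadditive extension of \<open>(a \<tau>\<^sup>i) (b \<tau>\<^sup>j) = a \<cdot> frob i b \<cdot> \<tau>\<^bsup>i+j\<^esup>\<close>.
\<close>

definition tw_mult ::
    "'a::finite_field alg_closure poly \<Rightarrow> 'a alg_closure poly \<Rightarrow> 'a alg_closure poly" where
  "tw_mult f g = (\<Sum>i\<le>Polynomial.degree f. \<Sum>j\<le>Polynomial.degree g.
     Polynomial.monom (poly.coeff f i * frob i (poly.coeff g j)) (i + j))"

primrec tw_power :: "'a::finite_field alg_closure poly \<Rightarrow> nat \<Rightarrow> 'a alg_closure poly" where
  "tw_power f 0 = 1"
| "tw_power f (Suc k) = tw_mult f (tw_power f k)"

definition tw_eval ::
    "'a::finite_field alg_closure poly \<Rightarrow> 'a alg_closure \<Rightarrow> 'a alg_closure" where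
  "tw_eval f x = (\<Sum>i\<le>Polynomial.degree f. poly.coeff f i * frob i x)"

text \<open>
  \<open>drinfeld t n a\<close> is \<open>\<phi>\<^sub>a = \<Sum>a\<^sub>i (t + \<tau>\<^sup>n)\<^sup>i\<close>. The lemmas at the end of this section show that
  \<open>a \<mapsto> \<phi>\<^sub>a\<close> is the homomorphism of \<open>F\<^sub>q\<close>-algebras with \<open>\<phi>\<^sub>T = t + \<tau>\<^sup>n\<close>. All coefficients of \<open>\<phi>\<^sub>a\<close>
  lie in the subfield generated by \<open>t\<close>.
\<close>

definition drinfeld ::
    "'a::finite_field alg_closure \<Rightarrow> nat \<Rightarrow> 'a poly \<Rightarrow> 'a alg_closure poly" where
  "drinfeld t n a = (\<Sum>i\<le>Polynomial.degree a.
     Polynomial.smult (to_ac (poly.coeff a i))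
       (tw_power ([:t:] + Polynomial.monom 1 n) i))"

lemma finite_field_binomial_eq_0:
  assumes "0 < k" "k < CARD('a::finite_field)"
  shows "of_nat (CARD('a) choose k) = (0::'a)"
proof -
  let ?q = "CARD('a)"
  define P :: "'a poly" where "P = [:1, 1:] ^ ?q - Polynomial.monom 1 ?q - 1"
  have q1: "?q > 1" using assms by linarith
  have root: "poly P x = 0" for x
    by (simp add: P_def poly_power poly_monom finite_field_power_card_eq_same)
  have deg: "Polynomial.degree P < ?q"
  proof (rule degree_lessI)
    show "P \<noteq> 0 \<or> 0 < ?q" using q1 by simp
    show "\<forall>j\<ge>?q. poly.coeff P j = 0"
    proof (intro allI impI)
      fix j assume j: "j \<ge> ?q"
      show "poly.coeff P j = 0"
      proof (cases "j = ?q")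
        case True
        then show ?thesis using q1 by (simp add: P_def coeff_linear_poly_power)
      next
        case False
        then have "Polynomial.degree ([:1, 1::'a:] ^ ?q) < j"
          using j by (simp add: degree_linear_power)
        then show ?thesis using False j q1
          by (simp add: P_def coeff_eq_0)
      qed
    qed
  qed
  have "P = 0"
  proof (rule ccontr)
    assume "P \<noteq> 0"
    from card_poly_roots_bound[OF this] root deg show False by simp
  qed
  then have "poly.coeff P k = 0" by simp
  then show ?thesis using assms by (simp add: P_def coeff_linear_poly_power)
qed

lemma frob_add: "frob i (x + y) = frob i x + frob i (y :: 'a::finite_field alg_closure)"
proof (induction i)
  case (Suc i)
  have step: "(x + y) ^ CARD('a) = x ^ CARD('a) + y ^ CARD('a)" for x y :: "'a alg_closure"
  proof -
    let ?q = "CARD('a)"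
    have q0: "?q > 0" by simp
    have "(x + y) ^ ?q = (\<Sum>k\<le>?q. of_nat (?q choose k) * x ^ k * y ^ (?q - k))"
      by (rule binomial_ring)
    also have "\<dots> = (\<Sum>k\<in>{0,?q}. of_nat (?q choose k) * x ^ k * y ^ (?q - k))"
    proof (intro sum.mono_neutral_right ballI)
      fix k assume "k \<in> {..?q} - {0, ?q}"
      then have "of_nat (?q choose k) = (0::'a)"
        by (intro finite_field_binomial_eq_0) auto
      then have "to_ac (of_nat (?q choose k) :: 'a) = 0" by simp
      then have "of_nat (?q choose k) = (0::'a alg_closure)" by (simp only: to_ac_of_nat)
      then show "of_nat (?q choose k) * x ^ k * y ^ (?q - k) = 0" by simp
    qed auto
    finally show ?thesis using q0 by (simp add: add_ac)
  qed
  have "frob (Suc i) z = frob i z ^ CARD('a)" for z :: "'a alg_closure"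
    by (simp add: frob_def power_mult [symmetric] mult.commute)
  then show ?case by (simp add: Suc step)
qed (simp add: frob_def)

lemma frob_mult: "frob i (x * y) = frob i x * frob i y"
  by (simp add: frob_def power_mult_distrib)

lemma frob_frob: "frob i (frob j x) = frob (i + j) x"
  by (simp add: frob_def power_mult [symmetric] power_add mult.commute)

lemma frob_0 [simp]: "frob i 0 = 0"
  by (simp add: frob_def)

lemma frob_1 [simp]: "frob i 1 = 1"
  by (simp add: frob_def)

lemma frob_to_ac [simp]: "frob i (to_ac c) = to_ac c"
  unfolding frob_def to_ac_power [symmetric]
  by (simp add: finite_field_power_card_power_eq_same)

lemma tw_mult_eq:
  assumes "Polynomial.degree f \<le> N" "Polynomial.degree g \<le> M"
  shows "tw_mult f g = (\<Sum>i\<le>N. \<Sum>j\<le>M.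
     Polynomial.monom (poly.coeff f i * frob i (poly.coeff g j)) (i + j))"
proof -
  have inner: "(\<Sum>j\<le>Polynomial.degree g.
      Polynomial.monom (poly.coeff f i * frob i (poly.coeff g j)) (i + j))
    = (\<Sum>j\<le>M. Polynomial.monom (poly.coeff f i * frob i (poly.coeff g j)) (i + j))" for i
    using assms(2) by (intro sum.mono_neutral_left) (auto simp: coeff_eq_0)
  show ?thesis unfolding tw_mult_def inner
    using assms(1) by (intro sum.mono_neutral_left) (auto simp: coeff_eq_0)
qed

lemma tw_mult_add_left: "tw_mult (f + g) h = tw_mult f h + tw_mult g h"
proof -
  define N where "N = max (Polynomial.degree f) (Polynomial.degree g)"
  have N: "Polynomial.degree f \<le> N" "Polynomial.degree g \<le> N" "Polynomial.degree (f + g) \<le> N"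
    unfolding N_def by (auto intro: degree_add_le)
  show ?thesis
    by (simp add: tw_mult_eq[OF N(1) order.refl] tw_mult_eq[OF N(2) order.refl]
        tw_mult_eq[OF N(3) order.refl] distrib_right add_monom [symmetric] sum.distrib)
qed

lemma tw_mult_add_right: "tw_mult f (g + h) = tw_mult f g + tw_mult f h"
proof -
  define N where "N = max (Polynomial.degree g) (Polynomial.degree h)"
  have N: "Polynomial.degree g \<le> N" "Polynomial.degree h \<le> N" "Polynomial.degree (g + h) \<le> N"
    unfolding N_def by (auto intro: degree_add_le)
  show ?thesis
    by (simp add: tw_mult_eq[OF order.refl N(1)] tw_mult_eq[OF order.refl N(2)]
        tw_mult_eq[OF order.refl N(3)] frob_add distrib_left add_monom [symmetric] sum.distrib)
qed

lemma tw_mult_0 [simp]: "tw_mult 0 f = 0" "tw_mult f 0 = 0"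
  by (simp_all add: tw_mult_def)

lemma tw_mult_sum_left: "tw_mult (\<Sum>i\<in>I. f i) g = (\<Sum>i\<in>I. tw_mult (f i) g)"
  by (induction I rule: infinite_finite_induct) (simp_all add: tw_mult_add_left)

lemma tw_mult_sum_right: "tw_mult g (\<Sum>i\<in>I. f i) = (\<Sum>i\<in>I. tw_mult g (f i))"
  by (induction I rule: infinite_finite_induct) (simp_all add: tw_mult_add_right)

lemma tw_mult_monom:
  "tw_mult (Polynomial.monom a i) (Polynomial.monom b j) = Polynomial.monom (a * frob i b) (i + j)"
proof -
  have "tw_mult (Polynomial.monom a i) (Polynomial.monom b j)
    = (\<Sum>i'\<le>i. \<Sum>j'\<le>j. if i' = i \<and> j' = j then Polynomial.monom (a * frob i b) (i + j) else 0)"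
    unfolding tw_mult_eq[OF degree_monom_le degree_monom_le] by (intro sum.cong) auto
  also have "\<dots> = (\<Sum>i'\<le>i. if i' = i then Polynomial.monom (a * frob i b) (i + j) else 0)"
    by (intro sum.cong) auto
  finally show ?thesis by simp
qed

lemma tw_mult_assoc: "tw_mult (tw_mult f g) h = tw_mult f (tw_mult g h)"
proof -
  let ?s = "\<lambda>f. \<Sum>i\<le>Polynomial.degree f. Polynomial.monom (poly.coeff f i) i"
  have "tw_mult (tw_mult (?s f) (?s g)) (?s h) = tw_mult (?s f) (tw_mult (?s g) (?s h))"
    by (simp add: tw_mult_sum_left tw_mult_sum_right tw_mult_monom frob_mult frob_frob
        mult.assoc add.assoc)
  then show ?thesis by (simp only: poly_as_sum_of_monoms)
qed

lemma smult_sum_right: "Polynomial.smult c (\<Sum>i\<in>I. f i) = (\<Sum>i\<in>I. Polynomial.smult c (f i))"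
  by (induction I rule: infinite_finite_induct) (simp_all add: smult_add_right)

lemma tw_mult_smult:
  "tw_mult (Polynomial.smult c f) g = Polynomial.smult c (tw_mult f g)"
  "tw_mult f (Polynomial.smult (to_ac e) g) = Polynomial.smult (to_ac e) (tw_mult f g)"
proof -
  show "tw_mult (Polynomial.smult c f) g = Polynomial.smult c (tw_mult f g)"
    by (subst tw_mult_eq[of _ "Polynomial.degree f" _ "Polynomial.degree g"])
      (auto simp: tw_mult_def smult_monom smult_sum_right mult.assoc degree_smult_le)
  show "tw_mult f (Polynomial.smult (to_ac e) g) = Polynomial.smult (to_ac e) (tw_mult f g)"
    by (subst tw_mult_eq[of _ "Polynomial.degree f" _ "Polynomial.degree g"])
      (auto simp: tw_mult_def smult_monom smult_sum_right frob_mult mult_ac degree_smult_le)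
qed

lemma tw_mult_1 [simp]: "tw_mult 1 f = f" "tw_mult f 1 = f"
proof -
  have 1: "(1 :: 'a alg_closure poly) = Polynomial.monom 1 0" by (simp add: monom_0 one_pCons)
  have frob0: "frob 0 x = x" for x :: "'a alg_closure" by (simp add: frob_def)
  have "tw_mult 1 (\<Sum>i\<le>Polynomial.degree f. Polynomial.monom (poly.coeff f i) i)
      = (\<Sum>i\<le>Polynomial.degree f. Polynomial.monom (poly.coeff f i) i)"
    unfolding 1 tw_mult_sum_right tw_mult_monom by (simp add: frob0)
  then show "tw_mult 1 f = f" by (simp only: poly_as_sum_of_monoms)
  have "tw_mult (\<Sum>i\<le>Polynomial.degree f. Polynomial.monom (poly.coeff f i) i) 1
      = (\<Sum>i\<le>Polynomial.degree f. Polynomial.monom (poly.coeff f i) i)"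
    unfolding 1 tw_mult_sum_left tw_mult_monom by simp
  then show "tw_mult f 1 = f" by (simp only: poly_as_sum_of_monoms)
qed

lemma tw_power_add: "tw_power f (i + j) = tw_mult (tw_power f i) (tw_power f j)"
  by (induction i) (simp_all add: tw_mult_assoc)

lemma drinfeld_eq:
  assumes "Polynomial.degree a \<le> N"
  shows "drinfeld t n a = (\<Sum>i\<le>N. Polynomial.smult (to_ac (poly.coeff a i))
       (tw_power ([:t:] + Polynomial.monom 1 n) i))"
  unfolding drinfeld_def using assms
  by (intro sum.mono_neutral_left) (auto simp: coeff_eq_0)

lemma drinfeld_add: "drinfeld t n (a + b) = drinfeld t n a + drinfeld t n b"
proof -
  define N where "N = max (Polynomial.degree a) (Polynomial.degree b)"
  have N: "Polynomial.degree a \<le> N" "Polynomial.degree b \<le> N" "Polynomial.degree (a + b) \<le> N"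
    unfolding N_def by (auto intro: degree_add_le)
  show ?thesis
    by (simp add: drinfeld_eq[OF N(1)] drinfeld_eq[OF N(2)] drinfeld_eq[OF N(3)]
        smult_add_left sum.distrib)
qed

lemma drinfeld_monom: "drinfeld t n (Polynomial.monom c k) =
    Polynomial.smult (to_ac c) (tw_power ([:t:] + Polynomial.monom 1 n) k)"
proof -
  let ?X = "tw_power ([:t:] + Polynomial.monom 1 n)"
  have "drinfeld t n (Polynomial.monom c k)
      = (\<Sum>i\<le>k. if i = k then Polynomial.smult (to_ac c) (?X k) else 0)"
    unfolding drinfeld_eq[OF degree_monom_le] by (intro sum.cong) auto
  then show ?thesis by simp
qed

lemma drinfeld_mult: "drinfeld t n (a * b) = tw_mult (drinfeld t n a) (drinfeld t n b)"
proof -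
  let ?X = "tw_power ([:t:] + Polynomial.monom 1 n)"
  let ?s = "\<lambda>f::'a poly. \<Sum>i\<le>Polynomial.degree f. Polynomial.monom (poly.coeff f i) i"
  have dsum: "drinfeld t n (\<Sum>i\<in>I. f i) = (\<Sum>i\<in>I. drinfeld t n (f i))"
    for I :: "nat set" and f
    by (induction I rule: infinite_finite_induct) (simp_all add: drinfeld_add, simp_all add: drinfeld_def)
  have "drinfeld t n (?s a * ?s b) = tw_mult (drinfeld t n (?s a)) (drinfeld t n (?s b))"
    unfolding sum_product mult_monom dsum drinfeld_monom tw_mult_sum_left tw_mult_sum_right
      tw_mult_smult tw_power_add to_ac_mult smult_smult
    by (subst sum.swap) (simp add: smult_sum_right mult.commute)
  then show ?thesis by (simp only: poly_as_sum_of_monoms)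
qed

lemma drinfeld_const: "drinfeld t n [:c:] = [:to_ac c:]"
  using drinfeld_monom[of t n c 0] by (simp add: monom_0)

lemma drinfeld_T: "drinfeld t n [:0, 1:] = [:t:] + Polynomial.monom 1 n"
  using drinfeld_monom[of t n 1 1] by (simp add: monom_Suc monom_0)

section \<open>The module of torsion points and its endomorphisms\<close>

definition torsion :: "'a::finite_field alg_closure \<Rightarrow> nat \<Rightarrow> 'a poly \<Rightarrow> 'a alg_closure set" where
  "torsion t n p = {v. tw_eval (drinfeld t n p) v = 0}"

text \<open>
  Endomorphisms of \<open>M\<close> are represented by functions on the whole algebraic closure which vanish
  outside \<open>M\<close>, so that equality of endomorphisms is equality of functions and the
  \<open>F\<^sub>q\<close>-vector space operations are pointwise.
\<close>

definition restrict0 :: "'b set \<Rightarrow> ('b \<Rightarrow> 'b::zero) \<Rightarrow> 'b \<Rightarrow> 'b" where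
  "restrict0 M f = (\<lambda>v. if v \<in> M then f v else 0)"

text \<open>
  The structure of a vector space over \<open>\<kappa> = A/(p)\<close> on \<open>M = torsion t n p\<close> is that induced by the
  action \<open>a \<cdot> v = \<phi>\<^sub>a(v)\<close> of \<open>A\<close>; a class in \<open>\<kappa>\<close> is throughout given by any of its representatives
  in \<open>A\<close>.
\<close>

definition End_ring :: "'a::finite_field alg_closure \<Rightarrow> nat \<Rightarrow> 'a poly
    \<Rightarrow> ('a alg_closure \<Rightarrow> 'a alg_closure) ring" where
  "End_ring t n p = (let M = torsion t n p in
    \<lparr> carrier = {f. (\<forall>v\<in>M. f v \<in> M) \<and> (\<forall>v. v \<notin> M \<longrightarrow> f v = 0) \<and>
                   (\<forall>v\<in>M. \<forall>w\<in>M. f (v + w) = f v + f w) \<and>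
                   (\<forall>a. \<forall>v\<in>M. f (tw_eval (drinfeld t n a) v) = tw_eval (drinfeld t n a) (f v))},
      monoid.mult = (\<circ>), one = restrict0 M (\<lambda>v. v), ring.zero = 0, add = (+) \<rparr>)"

definition kappa :: "'a::finite_field alg_closure \<Rightarrow> nat \<Rightarrow> 'a poly
    \<Rightarrow> ('a alg_closure \<Rightarrow> 'a alg_closure) set" where
  "kappa t n p = {restrict0 (torsion t n p) (tw_eval (drinfeld t n a)) | a. True}"

definition frob_end :: "'a::finite_field alg_closure \<Rightarrow> nat \<Rightarrow> 'a poly \<Rightarrow> nat
    \<Rightarrow> 'a alg_closure \<Rightarrow> 'a alg_closure" where
  "frob_end t n p r = restrict0 (torsion t n p) (frob r)"

text \<open>\<open>S = \<kappa>[\<pi>]\<close>, \<open>R\<^sub>0 = \<kappa>[\<pi>\<^sup>m]\<close> with \<open>\<pi>\<close> the \<open>r\<close>-th Frobenius, and \<open>R\<close> the centralizer of \<open>R\<^sub>0\<close>.\<close>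

definition S_ring :: "'a::finite_field alg_closure \<Rightarrow> nat \<Rightarrow> 'a poly \<Rightarrow> nat
    \<Rightarrow> ('a alg_closure \<Rightarrow> 'a alg_closure) set" where
  "S_ring t n p r = generate_ring (End_ring t n p) (insert (frob_end t n p r) (kappa t n p))"

definition R0_ring :: "'a::finite_field alg_closure \<Rightarrow> nat \<Rightarrow> 'a poly \<Rightarrow> nat \<Rightarrow> nat
    \<Rightarrow> ('a alg_closure \<Rightarrow> 'a alg_closure) set" where
  "R0_ring t n p r m = generate_ring (End_ring t n p)
     (insert (frob_end t n p r [^]\<^bsub>End_ring t n p\<^esub> m) (kappa t n p))"

definition R_ring :: "'a::finite_field alg_closure \<Rightarrow> nat \<Rightarrow> 'a poly \<Rightarrow> nat \<Rightarrow> nat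
    \<Rightarrow> ('a alg_closure \<Rightarrow> 'a alg_closure) set" where
  "R_ring t n p r m = {f \<in> carrier (End_ring t n p). \<forall>g\<in>R0_ring t n p r m.
     f \<otimes>\<^bsub>End_ring t n p\<^esub> g = g \<otimes>\<^bsub>End_ring t n p\<^esub> f}"

section \<open>Rank-BCH codes\<close>

text \<open>
  \<open>\<alpha>, \<alpha>\<^bsup>[r]\<^esup>, \<dots>, \<alpha>\<^bsup>[r(n-1)]\<^esup>\<close> is a basis of \<open>M\<close> over \<open>A/(p)\<close>: it lies in \<open>M\<close>, spans, and is
  linearly independent (a coefficient \<open>c i\<close> vanishes in \<open>A/(p)\<close> iff \<open>p dvd c i\<close>).
\<close>

definition S_normal :: "'a::finite_field alg_closure \<Rightarrow> nat \<Rightarrow> 'a poly \<Rightarrow> nat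
    \<Rightarrow> 'a alg_closure \<Rightarrow> bool" where
  "S_normal t n p r \<alpha> \<longleftrightarrow>
     \<alpha> \<in> torsion t n p \<and>
     (\<forall>i<n. frob (r * i) \<alpha> \<in> torsion t n p) \<and>
     (\<forall>v\<in>torsion t n p. \<exists>c. v = (\<Sum>i<n. tw_eval (drinfeld t n (c i)) (frob (r * i) \<alpha>))) \<and>
     (\<forall>c. (\<Sum>i<n. tw_eval (drinfeld t n (c i)) (frob (r * i) \<alpha>)) = 0 \<longrightarrow> (\<forall>i<n. p dvd c i))"

definition W_space :: "'a::finite_field alg_closure \<Rightarrow> nat \<Rightarrow> 'a poly \<Rightarrow> nat \<Rightarrow> nat
    \<Rightarrow> 'a alg_closure \<Rightarrow> nat \<Rightarrow> 'a alg_closure set" where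
  "W_space t n p r m \<alpha> \<delta> =
     {\<Sum>i<\<delta> - 1. g i (frob (r * i) \<alpha>) | g. \<forall>i<\<delta> - 1. g i \<in> R0_ring t n p r m}"

definition Ann :: "'a::finite_field alg_closure \<Rightarrow> nat \<Rightarrow> 'a poly \<Rightarrow> nat \<Rightarrow> nat
    \<Rightarrow> 'a alg_closure set \<Rightarrow> ('a alg_closure \<Rightarrow> 'a alg_closure) set" where
  "Ann t n p r m W = {f \<in> R_ring t n p r m. \<forall>w\<in>W. f w = 0}"

definition rank_BCH :: "'a::finite_field alg_closure \<Rightarrow> nat \<Rightarrow> 'a poly \<Rightarrow> nat \<Rightarrow> nat
    \<Rightarrow> 'a alg_closure \<Rightarrow> nat \<Rightarrow> ('a alg_closure \<Rightarrow> 'a alg_closure) set" where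
  "rank_BCH t n p r m \<alpha> \<delta> = Ann t n p r m (W_space t n p r m \<alpha> \<delta>)"

section \<open>Matrices of codewords\<close>

definition subfield_L :: "nat \<Rightarrow> 'a::finite_field alg_closure set" where
  "subfield_L m = {x. frob m x = x}"

definition is_basis :: "('a::field \<Rightarrow> 'b::ab_group_add \<Rightarrow> 'b) \<Rightarrow> nat \<Rightarrow> (nat \<Rightarrow> 'b) \<Rightarrow> 'b set \<Rightarrow> bool"
  where "is_basis scale N b V \<longleftrightarrow>
    inj_on b {..<N} \<and> \<not> Modules.module.dependent scale (b ` {..<N}) \<and>
    Modules.module.span scale (b ` {..<N}) = V"

definition scale_ac :: "'a::finite_field \<Rightarrow> 'a alg_closure \<Rightarrow> 'a alg_closure" where
  "scale_ac c x = to_ac c * x"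

definition scale_fun :: "'a::finite_field \<Rightarrow> ('a alg_closure \<Rightarrow> 'a alg_closure)
    \<Rightarrow> 'a alg_closure \<Rightarrow> 'a alg_closure" where
  "scale_fun c f = (\<lambda>v. to_ac c * f v)"

lemma vector_space_scale_ac: "vector_space scale_ac"
  by unfold_locales (simp_all add: scale_ac_def algebra_simps)

lemma vector_space_scale_fun: "vector_space scale_fun"
  by unfold_locales (simp_all add: scale_fun_def algebra_simps fun_eq_iff)

text \<open>
  \<open>coord_mat m N lam s f\<close> is the matrix \<open>A\<^sub>f = (a\<^sub>i\<^sub>j)\<close> with \<open>f = \<Sum>\<^sub>j (\<Sum>\<^sub>i a\<^sub>i\<^sub>j lam\<^sub>i) s\<^sub>j\<close>, where elements of
  \<open>L\<close> act by scalar multiplication.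
\<close>

definition coord_mat :: "nat \<Rightarrow> nat \<Rightarrow> (nat \<Rightarrow> 'a::finite_field alg_closure)
    \<Rightarrow> (nat \<Rightarrow> 'a alg_closure \<Rightarrow> 'a alg_closure) \<Rightarrow> ('a alg_closure \<Rightarrow> 'a alg_closure) \<Rightarrow> 'a mat"
  where "coord_mat m N lam s f = (THE A. A \<in> carrier_mat m N \<and>
    f = (\<lambda>v. \<Sum>j<N. (\<Sum>i<m. to_ac (A $$ (i, j)) * lam i) * s j v))"

definition mult_mat :: "nat \<Rightarrow> (nat \<Rightarrow> 'a::finite_field alg_closure) \<Rightarrow> 'a alg_closure \<Rightarrow> 'a mat"
  where "mult_mat m lam z = (THE B. B \<in> carrier_mat m m \<and>
    (\<forall>k<m. z * lam k = (\<Sum>i<m. to_ac (B $$ (i, k)) * lam i)))"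

definition Fqm_linear :: "nat \<Rightarrow> (nat \<Rightarrow> 'a::finite_field alg_closure) \<Rightarrow> 'a mat set \<Rightarrow> bool" where
  "Fqm_linear m lam C \<longleftrightarrow> (\<forall>z\<in>subfield_L m. \<forall>A\<in>C. mult_mat m lam z * A \<in> C)"

section \<open>Rank-metric codes\<close>

definition Fq_linear :: "nat \<Rightarrow> nat \<Rightarrow> 'a::field mat set \<Rightarrow> bool" where
  "Fq_linear a b C \<longleftrightarrow> VectorSpace.subspace class_ring C (module_mat TYPE('a) a b)"

definition mat_dim :: "nat \<Rightarrow> nat \<Rightarrow> 'a::field mat set \<Rightarrow> nat" where
  "mat_dim a b C = vectorspace.dim class_ring ((module_mat TYPE('a) a b)\<lparr>carrier := C\<rparr>)"

definition d_R :: "nat \<Rightarrow> nat \<Rightarrow> 'a::field mat set \<Rightarrow> nat" where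
  "d_R a b C = Min {vec_space.rank a A | A. A \<in> C \<and> A \<noteq> 0\<^sub>m a b}"

definition is_MRD :: "nat \<Rightarrow> nat \<Rightarrow> 'a::field mat set \<Rightarrow> bool" where
  "is_MRD a b C \<longleftrightarrow> Fq_linear a b C \<and> C \<noteq> {0\<^sub>m a b} \<and> a \<le> b \<and>
     int (mat_dim a b C) = int b * (int a - int (d_R a b C) + 1)"

end

theory Submission
  imports Defs
begin

text \<open>
  Write \<open>q = CARD('a)\<close>, \<open>\<pi> = \<tau>\<^sup>r\<close> and \<open>\<sigma>\<close> for the restriction of \<open>\<pi>\<close> to \<open>L\<close>, the field with \<open>q\<^sup>m\<close>
  elements. Since \<open>t\<close> lies in the field with \<open>q\<^sup>r\<close> elements and \<open>m\<close> divides \<open>n\<close>, both \<open>\<pi>\<close> and the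
  scalars from \<open>L\<close> commute with \<open>\<phi>\<^sub>T = t + \<tau>\<^sup>n\<close>, and \<open>\<pi> \<zeta> = \<sigma>(\<zeta>) \<pi>\<close>. As \<open>m\<close> and \<open>r\<close> are coprime, the
  fixed field of \<open>\<sigma>\<close> in \<open>L\<close> is the base field (\<open>frob_coprime_fixed\<close>). Two consequences of this carry
  the proof, and everything else is counting.

  The first is Galois descent. The \<open>L\<close>-linear relations between the members \<open>s\<^sub>j\<close> of a basis of \<open>S\<close>
  form a \<open>\<sigma>\<close>-stable \<open>L\<close>-space, so that a nonzero relation would yield one over the base field
  (\<open>galois_descent_independent\<close>). Therefore \<open>A \<mapsto> \<Sum>\<^sub>j (\<Sum>\<^sub>i a\<^sub>i\<^sub>j \<lambda>\<^sub>i) s\<^sub>j\<close> is an injection of the matrices into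
  \<open>R\<close>. On the other hand an element of \<open>R\<close> commutes with \<open>\<kappa>\<close> and \<open>\<pi>\<^sup>m\<close>, so it is determined by its
  values at \<open>\<alpha>, \<pi>\<alpha>, \<dots>, \<pi>\<^bsup>m-1\<^esup>\<alpha>\<close>, which gives an injection of \<open>R\<close> into \<open>M\<^sup>m\<close>. The normal basis gives
  \<open>|M| = q\<^bsup>nd\<^esup>\<close>, so the set of matrices and \<open>M\<^sup>m\<close> both have \<open>q\<^bsup>nd m\<^esup>\<close> elements, and both injections
  are bijections (\<open>word_orbit_bij\<close>). The code consists of the elements of \<open>R\<close> whose first \<open>\<delta> - 1\<close>
  values vanish; the other \<open>m - \<delta> + 1\<close> values are arbitrary, which gives the dimension.

  The second is the nonvanishing of Moore determinants (\<open>moore_independent\<close>): if \<open>\<mu>\<^sub>1, \<dots>, \<mu>\<^sub>\<rho>\<close> in \<open>L\<close>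
  are linearly independent over the base field and \<open>\<Sum>\<^sub>i \<mu>\<^sub>i \<pi>\<^sup>k(v\<^sub>i) = 0\<close> for all \<open>k < \<rho>\<close>, then all \<open>v\<^sub>i\<close>
  are \<open>0\<close>. A codeword \<open>f\<close> whose matrix has rank \<open>\<rho>\<close> can be written as \<open>\<Sum>\<^sub>i \<mu>\<^sub>i s'\<^sub>i\<close> with such \<open>\<mu>\<^sub>i\<close> and with
  \<open>s'\<^sub>i\<close> in \<open>S\<close>, and then \<open>f(\<pi>\<^sup>k \<alpha>) = \<Sum>\<^sub>i \<mu>\<^sub>i \<pi>\<^sup>k(s'\<^sub>i \<alpha>)\<close> because \<open>S\<close> commutes with \<open>\<pi>\<close>. If \<open>\<rho> < \<delta>\<close>, these
  values vanish for all \<open>k < \<rho>\<close>, so every \<open>s'\<^sub>i \<alpha>\<close> is \<open>0\<close> and \<open>f = 0\<close>. A codeword of rank at most \<open>\<delta>\<close>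
  exists by the Singleton argument: there are too many codewords for their last \<open>m - \<delta>\<close> rows to be
  pairwise distinct.
\<close>

no_notation fps_nth (infixl "$" 75)

section \<open>Counting over a finite field\<close>

lemma card_field_gt_1: "CARD('a::finite_field) > 1"
proof -
  have "card {0, 1 :: 'a} \<le> CARD('a)" by (intro card_mono) auto
  then show ?thesis by simp
qed

lemma card_poly_degree_less:
  assumes "d > 0"
  shows "finite {a :: 'a::finite_field poly. Polynomial.degree a < d} \<and>
    card {a :: 'a poly. Polynomial.degree a < d} = CARD('a) ^ d"
  using assms
proof (induction d rule: nat_induct_non_zero)
  case 1
  have "{a :: 'a poly. Polynomial.degree a < 1} = range (\<lambda>c. [:c:])"
    by (auto elim: degree_eq_zeroE)
  then show ?case by (simp add: card_image inj_def)
next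
  case (Suc d)
  let ?P = "\<lambda>d. {a :: 'a poly. Polynomial.degree a < d}"
  have eq: "?P (Suc d) = (\<lambda>(c, a). pCons c a) ` (UNIV \<times> ?P d)"
  proof (intro equalityI subsetI)
    fix a assume a: "a \<in> ?P (Suc d)"
    obtain c b where "a = pCons c b" by (cases a) auto
    with a Suc.hyps show "a \<in> (\<lambda>(c, a). pCons c a) ` (UNIV \<times> ?P d)"
      by (cases "b = 0") (auto simp: image_iff)
  next
    fix a assume "a \<in> (\<lambda>(c, a). pCons c a) ` (UNIV \<times> ?P d)"
    then obtain c b where "a = pCons c b" "Polynomial.degree b < d" by auto
    then show "a \<in> ?P (Suc d)"
      using degree_pCons_le[of c b] by auto
  qed
  have inj: "inj_on (\<lambda>(c, a). pCons c a) (UNIV \<times> ?P d)"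
    by (auto simp: inj_on_def)
  show ?case unfolding eq card_image[OF inj] using Suc.IH
    by (simp add: card_cartesian_product)
qed

text \<open>
  A vector is a unique linear combination of a basis, and a combination is a function from the basis
  to the scalars. This turns dimensions into cardinalities, for the code as well as for the column
  space of a matrix.
\<close>
lemma card_eq_power_dim:
  fixes V :: "('a::finite_field, 'v, 'x) module_scheme"
  assumes V: "vectorspace class_ring V" and fin: "finite (carrier V)"
  shows "card (carrier V) = CARD('a) ^ vectorspace.dim class_ring V"
proof -
  interpret V: vectorspace "class_ring :: 'a ring" V by (rule V)
  have "V.gen_set (carrier V)" using V.span_is_subset2 V.in_own_span by blast
  then have "V.fin_dim" unfolding V.fin_dim_def using fin by blast
  then obtain B where B: "finite B" "V.basis B" using V.finite_basis_exists by blast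
  then have BV: "B \<subseteq> carrier V" by (simp add: V.basis_def)
  let ?E = "B \<rightarrow>\<^sub>E (UNIV :: 'a set)"
  have ex1: "\<exists>!a. a \<in> ?E \<and> V.lincomb a B = v" if "v \<in> carrier V" for v
    using V.basis_criterion[OF B(1) BV] B(2) that by simp
  have closed: "V.lincomb a B \<in> carrier V" if "a \<in> ?E" for a
    using BV by (intro V.lincomb_closed) auto
  have "bij_betw (\<lambda>a. V.lincomb a B) ?E (carrier V)"
    unfolding bij_betw_def inj_on_def
  proof (intro conjI ballI impI equalityI subsetI)
    fix a b assume "a \<in> ?E" "b \<in> ?E" "V.lincomb a B = V.lincomb b B"
    then show "a = b" using ex1[OF closed] by metis
  next
    fix v assume "v \<in> (\<lambda>a. V.lincomb a B) ` ?E"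
    then show "v \<in> carrier V" using closed by auto
  next
    fix v assume "v \<in> carrier V"
    then show "v \<in> (\<lambda>a. V.lincomb a B) ` ?E" using ex1 by (metis (no_types, lifting) imageI)
  qed
  then have "card (carrier V) = card ?E" by (simp add: bij_betw_same_card)
  also have "\<dots> = CARD('a) ^ V.dim"
    using B by (simp add: card_PiE V.dim_basis)
  finally show ?thesis .
qed

lemma card_carrier_mat:
  "finite (carrier_mat m N :: 'a::finite mat set) \<and> card (carrier_mat m N :: 'a mat set) = CARD('a) ^ (m * N)"
proof -
  let ?I = "{..<m} \<times> {..<N}"
  let ?E = "?I \<rightarrow>\<^sub>E (UNIV :: 'a set)"
  have bij: "bij_betw (mat m N) ?E (carrier_mat m N)"
    unfolding bij_betw_def
  proof (intro conjI inj_onI equalityI subsetI)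
    fix f g assume fg: "f \<in> ?E" "g \<in> ?E" "mat m N f = mat m N g"
    have "f (i, j) = g (i, j)" if "i < m" "j < N" for i j
      using arg_cong[OF fg(3), of "\<lambda>A. A $$ (i, j)"] that by simp
    then show "f = g" using fg by (intro PiE_ext) auto
  next
    fix A :: "'a mat" assume A: "A \<in> carrier_mat m N"
    have "A = mat m N (restrict (\<lambda>ij. A $$ ij) ?I)"
      by (rule eq_matI) (use A in simp_all)
    moreover have "restrict (\<lambda>ij. A $$ ij) ?I \<in> ?E" by simp
    ultimately show "A \<in> mat m N ` ?E" by (rule image_eqI)
  qed auto
  have "finite ?E" by (intro finite_PiE) auto
  with bij show ?thesis
    using bij_betw_finite[OF bij] bij_betw_same_card[OF bij] by (simp add: card_PiE power_mult[symmetric])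
qed

text \<open>
  The column space consists of vectors supported on the first \<open>\<delta>\<close> coordinates, of which there are
  only \<open>q\<^sup>\<delta>\<close>.
\<close>
lemma rank_le_nonzero_rows:
  fixes A :: "'a::finite_field mat"
  assumes A: "A \<in> carrier_mat m N" and \<delta>: "\<delta> \<le> m"
    and zero: "\<And>i j. \<delta> \<le> i \<Longrightarrow> i < m \<Longrightarrow> j < N \<Longrightarrow> A $$ (i, j) = 0"
  shows "vec_space.rank m A \<le> \<delta>"
proof -
  interpret vec_space "TYPE('a)" m .
  let ?U = "span (set (cols A))"
  have cols: "set (cols A) \<subseteq> carrier_vec m" using A cols_dim by blast
  let ?W = "{v :: 'a vec. v \<in> carrier_vec m \<and> (\<forall>i. \<delta> \<le> i \<longrightarrow> i < m \<longrightarrow> v $ i = 0)}"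
  have UW: "?U \<subseteq> ?W"
  proof
    fix v assume v: "v \<in> ?U"
    then obtain a where a: "lincomb a (set (cols A)) = v"
      using finite_in_span[of "set (cols A)" v] cols by auto
    have "v $ i = 0" if "\<delta> \<le> i" "i < m" for i
    proof -
      have "x $ i = 0" if "x \<in> set (cols A)" for x :: "'a vec"
        using that \<open>\<delta> \<le> i\<close> \<open>i < m\<close> A zero by (auto simp: cols_def)
      then show ?thesis using lincomb_index[OF \<open>i < m\<close> cols, of a] by (simp add: a)
    qed
    moreover have "v \<in> carrier_vec m" using span_closed[OF cols v] by simp
    ultimately show "v \<in> ?W" by auto
  qed
  let ?E = "{..<\<delta>} \<rightarrow>\<^sub>E (UNIV :: 'a set)"
  have inj: "inj_on (\<lambda>v. restrict (($) v) {..<\<delta>}) ?W"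
  proof (rule inj_onI)
    fix v w assume vw: "v \<in> ?W" "w \<in> ?W" "restrict (($) v) {..<\<delta>} = restrict (($) w) {..<\<delta>}"
    show "v = w"
    proof (rule eq_vecI)
      fix i assume "i < dim_vec w"
      then show "v $ i = w $ i"
        using vw(1,2) fun_cong[OF vw(3), of i] by (cases "i < \<delta>") auto
    qed (use vw in auto)
  qed
  have finE: "finite ?E" by (intro finite_PiE) auto
  have W: "finite ?W" "card ?W \<le> CARD('a) ^ \<delta>"
  proof -
    have sub: "(\<lambda>v. restrict (($) v) {..<\<delta>}) ` ?W \<subseteq> ?E"
      by (intro image_subsetI restrict_PiE[THEN iffD2]) simp
    show "finite ?W" using inj_on_finite[OF inj sub finE] .
    show "card ?W \<le> CARD('a) ^ \<delta>" using card_inj_on_le[OF inj sub finE] by (simp add: card_PiE)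
  qed
  have vs: "vectorspace class_ring (span_vs (set (cols A)))"
    using subspace_is_vs[OF span_is_subspace] cols by simp
  have "CARD('a) ^ rank A = card ?U"
    unfolding rank_def using card_eq_power_dim[OF vs] finite_subset[OF UW W(1)] by simp
  also have "\<dots> \<le> CARD('a) ^ \<delta>" by (rule order.trans[OF card_mono[OF W(1) UW] W(2)])
  finally show ?thesis by (rule power_le_imp_le_exp[OF card_field_gt_1])
qed

text \<open>
  The full rank factorisation: \<open>B\<close> is a maximal independent set of columns. Read through
  \<open>\<lambda>\<^sub>0, \<dots>, \<lambda>\<^bsub>m-1\<^esub>\<close>, it rewrites a codeword as a combination of as few elements of \<open>L\<close> as its rank.
\<close>
lemma rank_factorisation:
  fixes A :: "'a::field mat"
  assumes A: "A \<in> carrier_mat m N"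
  obtains B :: "'a vec set" and c where "finite B" "card B = vec_space.rank m A"
    and "\<And>i j. i < m \<Longrightarrow> j < N \<Longrightarrow> A $$ (i, j) = (\<Sum>b\<in>B. c b j * b $ i)"
    and "\<And>e. (\<And>i. i < m \<Longrightarrow> (\<Sum>b\<in>B. e b * b $ i) = 0) \<Longrightarrow> (\<And>b. b \<in> B \<Longrightarrow> e b = 0)"
proof -
  interpret vec_space "TYPE('a)" m .
  have cols: "set (cols A) \<subseteq> carrier_vec m" using A cols_dim by blast
  obtain B where B: "finite B" "maximal B (\<lambda>T. T \<subseteq> set (cols A) \<and> lin_indpt T)"
    using maximal_exists_superset[of "set (cols A)" "\<lambda>T. T \<subseteq> set (cols A) \<and> lin_indpt T" "{}"]
    by (auto simp: lin_dep_def)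
  have BA: "B \<subseteq> set (cols A)" "lin_indpt B" using B(2) by (auto simp: maximal_def)
  then have Bc: "B \<subseteq> carrier_vec m" using cols by auto
  have in_span: "v \<in> span B" if v: "v \<in> set (cols A)" for v
  proof (rule ccontr)
    assume nv: "v \<notin> span B"
    then have "v \<notin> B" using in_own_span[of B] Bc by auto
    moreover have "lin_indpt (insert v B)"
      using lin_dep_iff_in_span[of B v] BA(2) Bc nv \<open>v \<notin> B\<close> v cols by auto
    ultimately have "insert v B = B"
      using B(2) v BA(1) unfolding maximal_def by auto
    with \<open>v \<notin> B\<close> show False by auto
  qed
  have "\<exists>a. \<forall>i<m. A $$ (i, j) = (\<Sum>b\<in>B. a b * b $ i)" if j: "j < N" for j
  proof -
    have "col A j \<in> set (cols A)" using A j by (auto simp: cols_def)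
    then obtain a where a: "lincomb a B = col A j"
      using finite_in_span[OF B(1) _ in_span] Bc by auto
    have "A $$ (i, j) = (\<Sum>b\<in>B. a b * b $ i)" if "i < m" for i
      using lincomb_index[OF that Bc, of a] A j that by (simp add: a)
    then show ?thesis by blast
  qed
  then obtain c where c: "\<And>i j. j < N \<Longrightarrow> i < m \<Longrightarrow> A $$ (i, j) = (\<Sum>b\<in>B. c j b * b $ i)"
    by metis
  show ?thesis
  proof (rule that[of B "\<lambda>b j. c j b"])
    show "card B = rank A" using rank_card_indpt[OF A B(2)] by simp
  next
    fix e b assume e: "\<And>i. i < m \<Longrightarrow> (\<Sum>b\<in>B. e b * b $ i) = 0" and b: "b \<in> B"
    have "lincomb e B = 0\<^sub>v m"
    proof (rule eq_vecI)
      fix i assume "i < dim_vec (0\<^sub>v m :: 'a vec)"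
      then show "lincomb e B $ i = 0\<^sub>v m $ i" using lincomb_index[of i B, where a = e] Bc e by simp
    qed (use lincomb_dim[OF B(1) Bc] in simp)
    then show "e b = 0"
      using lin_dep_crit[OF B(1) order.refl, where a = e and v = b] BA(2) b by auto
  qed (use B c in auto)
qed

section \<open>Frobenius and the field extension\<close>

text \<open>
  The ring generated by \<open>t\<close> over the base field has \<open>q\<^sup>r\<close> elements, because \<open>p0\<close> is the minimal
  polynomial of \<open>t\<close>. If \<open>t\<close> is not \<open>0\<close>, multiplication by \<open>t\<close> permutes the nonzero elements;
  comparing their product before and after gives \<open>t ^ (q\<^sup>r - 1) = 1\<close>.
\<close>
lemma frob_root:
  fixes p0 :: "'a::finite_field poly"
  assumes irr: "Factorial_Ring.irreducible p0" and root: "poly (map_poly to_ac p0) t = 0"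
  shows "frob (Polynomial.degree p0) t = t"
proof (cases "t = 0")
  case False
  let ?r = "Polynomial.degree p0"
  define ev where "ev a = poly (map_poly to_ac a) t" for a :: "'a poly"
  have ev_0: "ev 0 = 0" by (simp add: ev_def)
  have ev_pCons: "ev (pCons c a) = to_ac c + t * ev a" for c a
    by (simp add: ev_def map_poly_pCons)
  have ev_add: "ev (a + b) = ev a + ev b" for a b
  proof -
    have "map_poly to_ac (a + b) = map_poly to_ac a + map_poly to_ac b"
      by (intro poly_eqI) (simp add: coeff_map_poly)
    then show ?thesis by (simp add: ev_def)
  qed
  have ev_smult: "ev (Polynomial.smult c a) = to_ac c * ev a" for c a
    by (simp add: ev_def map_poly_smult)
  have ev_mult: "ev (a * b) = ev a * ev b" for a b
    by (induction a) (simp_all add: ev_0 ev_add ev_smult ev_pCons algebra_simps)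
  have ev_minus: "ev (a - b) = ev a - ev b" for a b
    using ev_add[of "a - b" b] by simp
  have p0: "p0 \<noteq> 0" "?r > 0"
    using irr by (auto simp: Factorial_Ring.irreducible_def is_unit_iff_degree)
  have ev_p0: "ev p0 = 0" using root by (simp add: ev_def)
  (* A polynomial e of least degree vanishing at t divides p0, hence is p0 up to a unit. *)
  have min: "?r \<le> Polynomial.degree c" if c: "c \<noteq> 0" "ev c = 0" for c
  proof -
    obtain e where e: "e \<noteq> 0" "ev e = 0" and
      e_min: "\<And>b. b \<noteq> 0 \<Longrightarrow> ev b = 0 \<Longrightarrow> Polynomial.degree e \<le> Polynomial.degree b"
      using ex_has_least_nat[of "\<lambda>b. b \<noteq> 0 \<and> ev b = 0" c Polynomial.degree] c by blast
    have "ev (p0 mod e) = 0"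
      using ev_p0 e(2) by (simp add: minus_div_mult_eq_mod[symmetric] ev_minus ev_mult)
    then have "p0 mod e = 0"
      using e_min[of "p0 mod e"] degree_mod_less'[OF e(1), of p0] by fastforce
    then obtain b where b: "p0 = e * b" by (auto simp: mod_eq_0_iff_dvd elim: dvdE)
    have "\<not> e dvd 1"
    proof
      assume "e dvd 1"
      then obtain x where "1 = e * x" by (rule dvdE)
      then have "ev 1 = 0" using ev_mult[of e x] e(2) by simp
      then show False using ev_pCons[of 1 0] by (simp add: ev_0 one_pCons)
    qed
    then have "b dvd 1" using irr b by (auto simp: Factorial_Ring.irreducible_def)
    moreover have "b \<noteq> 0" using b p0 by auto
    ultimately have "Polynomial.degree b = 0" "b \<noteq> 0" by (simp_all add: is_unit_iff_degree)
    then have "?r = Polynomial.degree e" using b e(1) by (simp add: degree_mult_eq)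
    then show ?thesis using e_min c by simp
  qed
  let ?P = "{a :: 'a poly. Polynomial.degree a < ?r}"
  have inj: "inj_on ev ?P"
  proof (rule inj_onI)
    fix a b assume ab: "a \<in> ?P" "b \<in> ?P" "ev a = ev b"
    then have "Polynomial.degree (a - b) < ?r" by (auto intro: degree_diff_less)
    then show "a = b" using min[of "a - b"] ab by (auto simp: ev_minus)
  qed
  define F where "F = ev ` ?P"
  have F: "finite F" "card F = CARD('a) ^ ?r" "0 \<in> F"
    using card_poly_degree_less[OF p0(2), where 'a = 'a] p0(2) ev_0
    by (auto simp: F_def card_image[OF inj] intro!: image_eqI[of _ _ 0])
  have tF: "t * x \<in> F" if "x \<in> F" for x
  proof -
    from that obtain a where a: "x = ev a" by (auto simp: F_def)
    have "t * x = ev (pCons 0 a mod p0)"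
      by (simp add: minus_div_mult_eq_mod[symmetric] ev_minus ev_mult ev_p0 ev_pCons a)
    moreover have "pCons 0 a mod p0 \<in> ?P"
      using degree_mod_less'[OF p0(1), of "pCons 0 a"] p0(2) by (cases "pCons 0 a mod p0 = 0") auto
    ultimately show ?thesis by (auto simp: F_def)
  qed
  let ?G = "F - {0}"
  have injt: "inj_on ((*) t) ?G" using False by (auto simp: inj_on_def)
  have img: "(*) t ` ?G = ?G"
    using F False tF by (intro card_subset_eq) (auto simp: card_image[OF injt])
  have "\<Prod>?G = \<Prod>((*) t ` ?G)" by (simp only: img)
  also have "\<dots> = t ^ card ?G * \<Prod>?G"
    by (simp add: prod.reindex[OF injt] prod.distrib)
  finally have "t ^ card ?G = 1" using F(1) by simp
  then have "t ^ Suc (card ?G) = t" by simp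
  then show ?thesis using F(2,3) F(1) by (simp add: frob_def card_Suc_Diff1 del: power_Suc)
qed (simp add: frob_def)

lemma frob_zero_exponent [simp]: "frob 0 x = x"
  by (simp add: frob_def)

lemma frob_sum: "frob i (\<Sum>x\<in>A. f x) = (\<Sum>x\<in>A. frob i (f x))"
  by (induction A rule: infinite_finite_induct) (simp_all add: frob_add)

lemma frob_minus: "frob i (- x) = - frob i x"
  using frob_add[of i "-x" x] by (simp add: eq_neg_iff_add_eq_0)

lemma frob_diff: "frob i (x - y) = frob i x - frob i y"
  using frob_add[of i x "-y"] by (simp add: frob_minus)

lemma frob_eq_0_iff [simp]: "frob i x = 0 \<longleftrightarrow> x = 0"
  by (simp add: frob_def)

lemma frob_divide: "frob i (x / y) = frob i x / frob i y"
  by (simp add: frob_def power_divide)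

lemma inj_frob: "inj (frob i)"
proof (rule injI)
  fix x y :: "'a alg_closure" assume "frob i x = frob i y"
  then have "frob i (x - y) = 0" by (simp add: frob_diff)
  then show "x = y" by simp
qed

lemma frob_iterate_fixed:
  assumes "frob i x = x" shows "frob (i * k) x = x"
proof (induction k)
  case (Suc k)
  have "frob (i * Suc k) x = frob i (frob (i * k) x)" by (simp add: frob_frob)
  then show ?case using Suc assms by simp
qed simp

text \<open>
  By Bezout the element is fixed by the \<open>q\<close>-power map itself, so it is a root of \<open>X\<^sup>q - X\<close>. The \<open>q\<close>
  elements of the base field are already all the roots. For \<open>i = m\<close> and \<open>j = r\<close> this says that the
  fixed field of \<open>\<sigma>\<close> in \<open>L\<close> is the base field.
\<close>
lemma frob_coprime_fixed:
  fixes x :: "'a::finite_field alg_closure"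
  assumes "coprime i j" "frob i x = x" "frob j x = x"
  shows "x \<in> range to_ac"
proof -
  have "frob 1 x = x"
  proof (cases "i = 0")
    case False
    then obtain a b where "i * a = j * b + 1"
      using bezout_nat[of i j] assms(1) by (auto simp: coprime_iff_gcd_eq_1)
    moreover have "frob (1 + j * b) x = frob 1 (frob (j * b) x)" by (simp only: frob_frob)
    ultimately show ?thesis using frob_iterate_fixed[OF assms(2), of a] frob_iterate_fixed[OF assms(3), of b]
      by (simp add: add.commute)
  qed (use assms in auto)
  then have x: "x ^ CARD('a) = x" by (simp add: frob_def)
  (* The polynomial X^q - X. *)
  let ?Q = "Polynomial.monom 1 CARD('a) - [:0, 1:] :: 'a alg_closure poly"
  have "poly.coeff ?Q CARD('a) = 1"
    using card_field_gt_1[where 'a = 'a] by (simp add: coeff_pCons split: nat.splits)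
  then have Q0: "?Q \<noteq> 0" by (metis coeff_0 zero_neq_one)
  have deg: "Polynomial.degree ?Q \<le> CARD('a)"
    using card_field_gt_1[where 'a = 'a] by (intro degree_diff_le) (auto simp: degree_monom_le)
  have roots: "{y. poly ?Q y = 0} = {y. y ^ CARD('a) = y}" by (simp add: poly_monom)
  have fin: "finite {y :: 'a alg_closure. y ^ CARD('a) = y}"
    using poly_roots_finite[OF Q0] by (simp only: roots)
  have "card {y :: 'a alg_closure. y ^ CARD('a) = y} \<le> CARD('a)"
    using card_poly_roots_bound[OF Q0] deg by (simp only: roots)
  moreover have "card (range to_ac :: 'a alg_closure set) = CARD('a)"
    by (simp add: card_image inj_to_ac)
  moreover have "range to_ac \<subseteq> {y :: 'a alg_closure. y ^ CARD('a) = y}"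
    using frob_to_ac[of 1] by (auto simp: frob_def)
  ultimately have "range to_ac = {y :: 'a alg_closure. y ^ CARD('a) = y}"
    using card_mono[OF fin, of "range to_ac"] by (intro card_subset_eq[OF fin] antisym) simp_all
  with x show ?thesis by auto
qed

section \<open>Independence through the Galois action\<close>

text \<open>
  The Moore matrix of independent elements is invertible. Induction on the number of elements: divide
  the relations by \<open>\<mu>\<^sub>j\<close>, so that the coefficient of \<open>v\<^sub>j\<close> is \<open>1\<close>; applying Frobenius to the \<open>k\<close>-th relation
  and subtracting the next one then eliminates \<open>v\<^sub>j\<close>. The new coefficients are \<open>\<sigma>(\<mu>\<^sub>i/\<mu>\<^sub>j) - \<mu>\<^sub>i/\<mu>\<^sub>j\<close>, and
  these are again independent because the kernel of \<open>\<sigma> - 1\<close> on \<open>L\<close> is the base field, the span of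
  \<open>\<mu>\<^sub>j/\<mu>\<^sub>j = 1\<close>.
\<close>
lemma moore_independent:
  fixes \<mu> v :: "'i \<Rightarrow> 'a::finite_field alg_closure"
  assumes cop: "coprime m r" and "finite I"
    and "\<And>i. i \<in> I \<Longrightarrow> \<mu> i \<in> subfield_L m"
    and "\<And>c i. (\<Sum>i\<in>I. to_ac (c i) * \<mu> i) = 0 \<Longrightarrow> i \<in> I \<Longrightarrow> c i = 0"
    and "\<And>k. k < card I \<Longrightarrow> (\<Sum>i\<in>I. \<mu> i * frob (r * k) (v i)) = 0"
    and "i \<in> I"
  shows "v i = 0"
  using assms(2-)
proof (induction I arbitrary: \<mu> v i rule: finite_induct)
  case (insert j J)
  have \<mu>j: "\<mu> j \<noteq> 0"
  proof
    assume "\<mu> j = 0"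
    then have "(\<Sum>i\<in>insert j J. to_ac (if i = j then 1 else 0) * \<mu> i) = 0"
      by (intro sum.neutral) auto
    from insert.prems(2)[OF this, of j] show False by simp
  qed
  define \<mu>' where "\<mu>' i = \<mu> i / \<mu> j" for i
  define \<nu> where "\<nu> i = frob r (\<mu>' i) - \<mu>' i" for i
  have L: "frob m (\<mu>' i) = \<mu>' i" if "i \<in> J" for i
  proof -
    have "\<mu> i \<in> subfield_L m" "\<mu> j \<in> subfield_L m"
      by (rule insert.prems(1), use that in simp)+
    then show ?thesis by (simp add: \<mu>'_def subfield_L_def frob_divide)
  qed
  have relk: "frob (r * k) (v j) + (\<Sum>i\<in>J. \<mu>' i * frob (r * k) (v i)) = 0" if "k < Suc (card J)" for k
  proof -
    have "(\<Sum>i\<in>insert j J. \<mu> i * frob (r * k) (v i)) = 0"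
      by (rule insert.prems(3)) (use insert.hyps that in simp)
    then have "\<mu> j * (frob (r * k) (v j) + (\<Sum>i\<in>J. \<mu>' i * frob (r * k) (v i))) = 0"
      using insert.hyps \<mu>j by (simp add: distrib_left sum_distrib_left \<mu>'_def)
    then show ?thesis using \<mu>j by simp
  qed
  have zero: "frob r (v i) = 0" if "i \<in> J" for i
  proof (rule insert.IH[of \<nu> "\<lambda>i. frob r (v i)"])
    show "\<nu> i \<in> subfield_L m" if "i \<in> J" for i
    proof -
      have "frob m (frob r (\<mu>' i)) = frob r (frob m (\<mu>' i))" by (simp add: frob_frob add.commute)
      then show ?thesis using L[OF that] by (simp add: \<nu>_def subfield_L_def frob_diff)
    qed
  next
    fix c i assume c: "(\<Sum>i\<in>J. to_ac (c i) * \<nu> i) = 0" and i: "i \<in> J"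
    define x where "x = (\<Sum>i\<in>J. to_ac (c i) * \<mu>' i)"
    have "frob r x - x = (\<Sum>i\<in>J. to_ac (c i) * \<nu> i)"
      by (simp add: x_def \<nu>_def frob_sum frob_mult sum_subtractf right_diff_distrib)
    then have "frob r x = x" using c by simp
    moreover have "frob m x = x" using L by (simp add: x_def frob_sum frob_mult)
    ultimately obtain e where e: "x = to_ac e" using frob_coprime_fixed[OF cop] by auto
    (* As x lies in the base field, it cancels against a multiple of the j-th element. *)
    have "(\<Sum>i\<in>insert j J. to_ac (if i = j then - e else c i) * \<mu> i)
        = - to_ac e * \<mu> j + (\<Sum>i\<in>J. to_ac (c i) * \<mu> i)"
      using insert.hyps by (auto intro!: sum.cong)
    also have "\<dots> = \<mu> j * (- to_ac e + x)"
      using \<mu>j by (simp add: x_def \<mu>'_def distrib_left sum_distrib_left right_diff_distrib mult_ac)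
    also have "\<dots> = 0" by (simp add: e)
    finally have "(if i = j then - e else c i) = 0"
      by (rule insert.prems(2)) (use i in auto)
    then show "c i = 0" using i insert.hyps by (auto split: if_splits)
  next
    fix k assume k: "k < card J"
    have fr: "frob r (frob (r * k) x) = frob (r * Suc k) x" "frob (r * k) (frob r x) = frob (r * Suc k) x"
      for x :: "'a alg_closure"
      by (simp_all add: frob_frob add.commute)
    have "0 = frob r (frob (r * k) (v j) + (\<Sum>i\<in>J. \<mu>' i * frob (r * k) (v i)))
        - (frob (r * Suc k) (v j) + (\<Sum>i\<in>J. \<mu>' i * frob (r * Suc k) (v i)))"
      using relk[of k] relk[of "Suc k"] k by simp
    also have "\<dots> = (\<Sum>i\<in>J. \<nu> i * frob (r * k) (frob r (v i)))"
      by (simp only: frob_add frob_sum frob_mult fr \<nu>_def left_diff_distrib sum_subtractf) simp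
    finally show "(\<Sum>i\<in>J. \<nu> i * frob (r * k) (frob r (v i))) = 0" by simp
  qed (rule that)
  then have J: "v i = 0" if "i \<in> J" for i using that by simp
  moreover have "v j = 0" using relk[of 0] J by simp
  ultimately show ?case using insert.prems(4) by auto
qed simp

text \<open>
  Artin's argument, by induction on the number of nonzero coefficients: after normalising one
  coefficient to \<open>1\<close>, the difference of the relation and its image under \<open>\<sigma>\<close> is shorter, hence trivial.
  So all coefficients are fixed by \<open>\<sigma>\<close> and lie in the base field, where independence is assumed.
\<close>
lemma galois_descent_independent:
  fixes b :: "nat \<Rightarrow> 'a::finite_field alg_closure"
  assumes cop: "coprime m r"
    and s_indep: "\<And>c j. (\<And>v. (\<Sum>j<N. to_ac (c j) * s j v) = 0) \<Longrightarrow> j < N \<Longrightarrow> c j = 0"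
    and s_frob: "\<And>b. (\<And>v. (\<Sum>j<N. b j * s j v) = 0) \<Longrightarrow> (\<And>v. (\<Sum>j<N. frob r (b j) * s j v) = 0)"
    and "\<And>j. j < N \<Longrightarrow> b j \<in> subfield_L m"
    and "\<And>v. (\<Sum>j<N. b j * s j v) = 0"
    and "j < N"
  shows "b j = 0"
  using assms(4-)
proof (induction "card {j. j < N \<and> b j \<noteq> 0}" arbitrary: b j rule: less_induct)
  case less
  show ?case
  proof (rule ccontr)
    assume bj: "b j \<noteq> 0"
    define b' where "b' i = b i / b j" for i
    define b'' where "b'' i = frob r (b' i) - b' i" for i
    have L': "frob m (b' i) = b' i" if "i < N" for i
      using less.prems(1)[OF that] less.prems(1)[OF \<open>j < N\<close>] by (simp add: b'_def subfield_L_def frob_divide)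
    have rel': "(\<Sum>j<N. b' j * s j v) = 0" for v
    proof -
      have "b j * (\<Sum>j<N. b' j * s j v) = (\<Sum>j<N. b j * s j v)"
        using bj by (simp add: b'_def sum_distrib_left)
      then show ?thesis using less.prems(2)[of v] bj by simp
    qed
    have "b'' i = 0" if "i < N" for i
    proof (rule less.hyps)
      have "{i. i < N \<and> b'' i \<noteq> 0} \<subset> {i. i < N \<and> b i \<noteq> 0}"
      proof (rule psubsetI)
        show "{i. i < N \<and> b'' i \<noteq> 0} \<subseteq> {i. i < N \<and> b i \<noteq> 0}"
          by (auto simp: b''_def b'_def)
        have "b'' j = 0" using bj by (simp add: b''_def b'_def)
        then show "{i. i < N \<and> b'' i \<noteq> 0} \<noteq> {i. i < N \<and> b i \<noteq> 0}"
          using bj less.prems(3) by blast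
      qed
      then show "card {i. i < N \<and> b'' i \<noteq> 0} < card {i. i < N \<and> b i \<noteq> 0}"
        by (intro psubset_card_mono) auto
    next
      show "b'' i \<in> subfield_L m" if "i < N" for i
      proof -
        have "frob m (frob r (b' i)) = frob r (frob m (b' i))" by (simp add: frob_frob add.commute)
        then show ?thesis using L'[OF that] by (simp add: b''_def subfield_L_def frob_diff)
      qed
    next
      show "(\<Sum>j<N. b'' j * s j v) = 0" for v
        using s_frob[OF rel', of v] rel'[of v] by (simp add: b''_def left_diff_distrib sum_subtractf)
    qed (rule that)
    then have "\<forall>i<N. \<exists>c. b' i = to_ac c"
      using frob_coprime_fixed[OF cop L'] by (fastforce simp: b''_def)
    then obtain c where c: "\<And>i. i < N \<Longrightarrow> b' i = to_ac (c i)" by metis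
    have "(\<Sum>i<N. to_ac (c i) * s i v) = 0" for v
      using rel'[of v] c by simp
    then have "c j = 0" using s_indep \<open>j < N\<close> by blast
    then show False using c[OF \<open>j < N\<close>] bj by (simp add: b'_def)
  qed
qed

section \<open>Evaluation of twisted polynomials\<close>

lemma tw_eval_eq:
  assumes "Polynomial.degree f \<le> N"
  shows "tw_eval f x = (\<Sum>i\<le>N. poly.coeff f i * frob i x)"
  unfolding tw_eval_def using assms
  by (intro sum.mono_neutral_left) (auto simp: coeff_eq_0)

lemma tw_eval_add_left: "tw_eval (f + g) x = tw_eval f x + tw_eval g x"
proof -
  define N where "N = max (Polynomial.degree f) (Polynomial.degree g)"
  have N: "Polynomial.degree f \<le> N" "Polynomial.degree g \<le> N" "Polynomial.degree (f + g) \<le> N"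
    unfolding N_def by (auto intro: degree_add_le)
  show ?thesis
    by (simp add: tw_eval_eq[OF N(1)] tw_eval_eq[OF N(2)] tw_eval_eq[OF N(3)]
        distrib_right sum.distrib)
qed

lemma tw_eval_add_right: "tw_eval f (x + y) = tw_eval f x + tw_eval f y"
  by (simp add: tw_eval_def frob_add distrib_left sum.distrib)

lemma tw_eval_0 [simp]: "tw_eval 0 x = 0" "tw_eval f 0 = 0"
  by (simp_all add: tw_eval_def)

lemma tw_eval_sum_left: "tw_eval (\<Sum>i\<in>I. f i) x = (\<Sum>i\<in>I. tw_eval (f i) x)"
  by (induction I rule: infinite_finite_induct) (simp_all add: tw_eval_add_left)

lemma tw_eval_monom: "tw_eval (Polynomial.monom c k) x = c * frob k x"
proof -
  have "tw_eval (Polynomial.monom c k) x = (\<Sum>i\<le>k. if i = k then c * frob k x else 0)"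
    unfolding tw_eval_eq[OF degree_monom_le] by (intro sum.cong) auto
  then show ?thesis by simp
qed

lemma tw_eval_tw_mult: "tw_eval (tw_mult f g) x = tw_eval f (tw_eval g x)"
proof -
  have "tw_eval (tw_mult f g) x = (\<Sum>i\<le>Polynomial.degree f. \<Sum>j\<le>Polynomial.degree g.
      poly.coeff f i * frob i (poly.coeff g j) * frob (i + j) x)"
    unfolding tw_mult_def by (simp add: tw_eval_sum_left tw_eval_monom)
  also have "\<dots> = tw_eval f (tw_eval g x)"
    by (simp add: tw_eval_def frob_sum frob_mult frob_frob sum_distrib_left mult.assoc)
  finally show ?thesis .
qed

lemma tw_eval_drinfeld_add:
  "tw_eval (drinfeld t n (a + b)) v = tw_eval (drinfeld t n a) v + tw_eval (drinfeld t n b) v"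
  by (simp add: drinfeld_add tw_eval_add_left)

lemma tw_eval_drinfeld_mult:
  "tw_eval (drinfeld t n (a * b)) v = tw_eval (drinfeld t n a) (tw_eval (drinfeld t n b) v)"
  by (simp add: drinfeld_mult tw_eval_tw_mult)

lemma tw_eval_drinfeld_pCons:
  "tw_eval (drinfeld t n (pCons c a)) v =
    to_ac c * v + (t * tw_eval (drinfeld t n a) v + frob n (tw_eval (drinfeld t n a) v))"
proof -
  have const: "tw_eval [:x:] w = x * w" for x w :: "'a alg_closure"
    using tw_eval_monom[of x 0 w] by (simp add: monom_0)
  have "pCons c a = [:c:] + [:0, 1:] * a" by simp
  then show ?thesis
    by (simp only: tw_eval_drinfeld_add tw_eval_drinfeld_mult drinfeld_const drinfeld_T
        tw_eval_add_left const tw_eval_monom mult_1)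
qed

text \<open>
  The ring \<open>A\<close> is generated by the constants and \<open>T\<close>, so commuting with their action is enough. The
  maps of interest are \<open>\<pi>\<close> and the scalars from \<open>L\<close>.
\<close>
lemma tw_eval_drinfeld_commute:
  assumes add: "\<And>v w. g (v + w) = g v + g w"
    and const: "\<And>c v. g (to_ac c * v) = to_ac c * g v"
    and gen: "\<And>v. g (t * v + frob n v) = t * g v + frob n (g v)"
  shows "g (tw_eval (drinfeld t n a) v) = tw_eval (drinfeld t n a) (g v)"
proof (induction a)
  case 0
  have "g 0 = 0" using const[of 0 0] by simp
  then show ?case by (simp add: drinfeld_def)
next
  case (pCons c a)
  then show ?case
    by (simp only: tw_eval_drinfeld_pCons add[of "to_ac c * v"] const gen)
qed

section \<open>Endomorphisms of the torsion module\<close>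

text \<open>
  The facts on \<open>t\<close>, \<open>n\<close>, \<open>r\<close> and \<open>m\<close> through which the structure of \<open>A\<close>-module interacts with \<open>\<pi>\<close> and \<open>L\<close>.
\<close>
locale drinfeld_torsion =
  fixes t :: "'a::finite_field alg_closure" and p :: "'a poly" and n r d m :: nat
  assumes t_fixed: "frob r t = t"
    and p_degree: "Polynomial.degree p = d" "0 < d"
    and m_dvd_n: "m dvd n" "0 < n"
    and coprime_m_r: "coprime m r"
begin

abbreviation act :: "'a poly \<Rightarrow> 'a alg_closure \<Rightarrow> 'a alg_closure" where
  "act a v \<equiv> tw_eval (drinfeld t n a) v"

abbreviation M :: "'a alg_closure set" where "M \<equiv> torsion t n p"

abbreviation E :: "('a alg_closure \<Rightarrow> 'a alg_closure) ring" where "E \<equiv> End_ring t n p"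

lemma act_frob: "act a (frob r v) = frob r (act a v)"
  by (rule tw_eval_drinfeld_commute[symmetric])
    (simp_all add: frob_add frob_mult frob_frob t_fixed add.commute)

lemma act_scale:
  assumes "z \<in> subfield_L m"
  shows "act a (z * v) = z * act a v"
proof -
  have "frob n z = z"
    using frob_iterate_fixed[of m z] m_dvd_n assms by (auto simp: subfield_L_def elim: dvdE)
  then show ?thesis
    by (intro tw_eval_drinfeld_commute[symmetric]) (simp_all add: frob_mult distrib_left mult_ac)
qed

lemma zero_M [simp]: "0 \<in> M"
  by (simp add: torsion_def)

lemma add_M: "v \<in> M \<Longrightarrow> w \<in> M \<Longrightarrow> v + w \<in> M"
  by (simp add: torsion_def tw_eval_add_right)

lemma act_M: "v \<in> M \<Longrightarrow> act a v \<in> M"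
  using tw_eval_drinfeld_mult[of t n a p v] tw_eval_drinfeld_mult[of t n p a v]
  by (simp add: torsion_def mult.commute)

lemma scale_M: "z \<in> subfield_L m \<Longrightarrow> v \<in> M \<Longrightarrow> z * v \<in> M"
  by (simp add: torsion_def act_scale)

lemma minus_M: "v \<in> M \<Longrightarrow> - v \<in> M"
  using scale_M[of "-1" v] by (simp add: subfield_L_def frob_minus)

lemma sum_M: "(\<And>i. i \<in> I \<Longrightarrow> f i \<in> M) \<Longrightarrow> (\<Sum>i\<in>I. f i) \<in> M"
  by (induction I rule: infinite_finite_induct) (simp_all add: add_M)

lemma frob_M: "v \<in> M \<Longrightarrow> frob r v \<in> M"
  by (simp add: torsion_def act_frob)

lemma frob_mult_M: "v \<in> M \<Longrightarrow> frob (r * k) v \<in> M"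
proof (induction k)
  case (Suc k)
  have "frob (r * Suc k) v = frob r (frob (r * k) v)" by (simp add: frob_frob)
  then show ?case using Suc frob_M by simp
qed simp

lemma act_minus: "act (a - b) v = act a v - act b v"
  using tw_eval_drinfeld_add[of t n "a - b" b v] by simp

lemma act_mod:
  assumes "v \<in> M"
  shows "act (a mod p) v = act a v"
proof -
  have "act a v = act (a mod p + p * (a div p)) v" by simp
  also have "\<dots> = act (a mod p) v + act (a div p) (act p v)"
    by (simp only: tw_eval_drinfeld_add mult.commute[of p] tw_eval_drinfeld_mult)
  finally show ?thesis using assms by (simp add: torsion_def)
qed

lemma E_simps [simp]:
  "f \<otimes>\<^bsub>E\<^esub> g = f \<circ> g" "f \<oplus>\<^bsub>E\<^esub> g = f + g" "\<zero>\<^bsub>E\<^esub> = 0" "\<one>\<^bsub>E\<^esub> = restrict0 M (\<lambda>v. v)"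
  by (simp_all add: End_ring_def Let_def)

lemma E_carrier_iff: "f \<in> carrier E \<longleftrightarrow>
    (\<forall>v\<in>M. f v \<in> M) \<and> (\<forall>v. v \<notin> M \<longrightarrow> f v = 0) \<and>
    (\<forall>v\<in>M. \<forall>w\<in>M. f (v + w) = f v + f w) \<and> (\<forall>a. \<forall>v\<in>M. f (act a v) = act a (f v))"
  by (simp add: End_ring_def Let_def)

context
  fixes f assumes f: "f \<in> carrier E"
begin

lemma E_M: "v \<in> M \<Longrightarrow> f v \<in> M"
  and E_outside: "v \<notin> M \<Longrightarrow> f v = 0"
  and E_add: "v \<in> M \<Longrightarrow> w \<in> M \<Longrightarrow> f (v + w) = f v + f w"
  and E_act: "v \<in> M \<Longrightarrow> f (act a v) = act a (f v)"
  using f by (simp_all add: E_carrier_iff)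

lemma E_zero: "f 0 = 0"
  using E_add[OF zero_M zero_M] by (metis add_0 add_cancel_right_right)

lemma E_range: "f v \<in> M"
  using E_M E_outside by (cases "v \<in> M") auto

lemma E_minus: "v \<in> M \<Longrightarrow> f (- v) = - f v"
  using E_add[of v "- v"] minus_M[of v] E_zero by (simp add: eq_neg_iff_add_eq_0 add.commute)

lemma E_sum: "(\<And>i. i \<in> I \<Longrightarrow> g i \<in> M) \<Longrightarrow> f (\<Sum>i\<in>I. g i) = (\<Sum>i\<in>I. f (g i))"
  by (induction I rule: infinite_finite_induct) (simp_all add: E_zero E_add sum_M)

end

lemma E_one_closed: "restrict0 M (\<lambda>v. v) \<in> carrier E"
  by (auto simp: E_carrier_iff restrict0_def add_M act_M)

lemma E_add_closed: "f \<in> carrier E \<Longrightarrow> g \<in> carrier E \<Longrightarrow> f + g \<in> carrier E"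
  unfolding E_carrier_iff by (auto simp: add_M tw_eval_add_right algebra_simps)

lemma act_uminus: "act a (- v) = - act a v"
  using act_scale[of "-1" a v] by (simp add: subfield_L_def frob_minus)

lemma E_uminus_closed: "f \<in> carrier E \<Longrightarrow> - f \<in> carrier E"
  unfolding E_carrier_iff by (auto simp: minus_M act_uminus)

lemma E_comp_closed: "f \<in> carrier E \<Longrightarrow> g \<in> carrier E \<Longrightarrow> f \<circ> g \<in> carrier E"
  by (simp add: E_carrier_iff[of "f \<circ> g"] E_M E_outside E_add E_act E_zero)

lemma E_scale_closed:
  "z \<in> subfield_L m \<Longrightarrow> f \<in> carrier E \<Longrightarrow> (\<lambda>v. z * f v) \<in> carrier E"
  unfolding E_carrier_iff by (auto simp: scale_M act_scale distrib_left)

text \<open>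
  The rings generated inside \<open>E\<close> are closed under its additive inverse, which is defined by a unique
  choice in the carrier and has to be identified with pointwise negation.
\<close>
lemma E_a_inv: "f \<in> carrier E \<Longrightarrow> \<ominus>\<^bsub>E\<^esub> f = - f"
  unfolding a_inv_def m_inv_def
  by (rule the_equality) (auto simp: E_uminus_closed eq_neg_iff_add_eq_0 add.commute)

lemma kappa_closed: "kappa t n p \<subseteq> carrier E"
  by (auto simp: kappa_def E_carrier_iff restrict0_def act_M add_M tw_eval_add_right
      tw_eval_drinfeld_mult[symmetric] mult.commute)

lemma frob_end_closed: "frob_end t n p r \<in> carrier E"
  by (auto simp: frob_end_def E_carrier_iff restrict0_def frob_M add_M frob_add act_M act_frob)

lemma frob_end_pow: "frob_end t n p r [^]\<^bsub>E\<^esub> k = restrict0 M (frob (r * k))"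
proof (induction k)
  case (Suc k)
  show ?case unfolding nat_pow_Suc Suc
    by (auto simp: frob_end_def restrict0_def fun_eq_iff frob_M frob_frob add.commute)
qed (simp add: restrict0_def)

lemma frob_pow_closed: "restrict0 M (frob (r * k)) \<in> carrier E"
proof (induction k)
  case (Suc k)
  have "restrict0 M (frob (r * Suc k)) = restrict0 M (frob (r * k)) \<circ> frob_end t n p r"
    by (auto simp: frob_end_def restrict0_def fun_eq_iff frob_M frob_frob add.commute)
  then show ?case using Suc frob_end_closed by (simp only: E_comp_closed)
qed (use E_one_closed in \<open>simp add: restrict0_def\<close>)

text \<open>
  Commuting with \<open>f\<close> is preserved by the ring operations, so it has to be tested on generators only.
\<close>
lemma generate_ring_commute:
  assumes H: "H \<subseteq> carrier E" and f: "f \<in> carrier E"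
    and comm: "\<And>h v. h \<in> H \<Longrightarrow> v \<in> M \<Longrightarrow> f (h v) = h (f v)"
    and g: "g \<in> generate_ring E H"
  shows "g \<in> carrier E \<and> (\<forall>v\<in>M. f (g v) = g (f v))"
  using g
proof (induction rule: generate_ring.induct)
  case one
  then show ?case using E_one_closed E_M[OF f] by (simp add: restrict0_def)
next
  case (incl h)
  then show ?case using H comm by auto
next
  case (a_inv h)
  then have h: "h \<in> carrier E" "\<And>v. v \<in> M \<Longrightarrow> f (h v) = h (f v)" by auto
  have "f ((- h) v) = (- h) (f v)" if "v \<in> M" for v
    using h(2)[OF that] E_minus[OF f E_M[OF h(1) that]] by simp
  then show ?case unfolding E_a_inv[OF h(1)] using E_uminus_closed[OF h(1)] by blast
next
  case (eng_add h k)
  then have hk: "h \<in> carrier E" "k \<in> carrier E"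
    "\<And>v. v \<in> M \<Longrightarrow> f (h v) = h (f v)" "\<And>v. v \<in> M \<Longrightarrow> f (k v) = k (f v)" by auto
  have "f ((h + k) v) = (h + k) (f v)" if "v \<in> M" for v
    using hk(3,4)[OF that] E_add[OF f E_M[OF hk(1) that] E_M[OF hk(2) that]] by simp
  then show ?case unfolding E_simps using E_add_closed[OF hk(1,2)] by blast
next
  case (eng_mult h k)
  then have hk: "h \<in> carrier E" "k \<in> carrier E"
    "\<And>v. v \<in> M \<Longrightarrow> f (h v) = h (f v)" "\<And>v. v \<in> M \<Longrightarrow> f (k v) = k (f v)" by auto
  have "f ((h \<circ> k) v) = (h \<circ> k) (f v)" if "v \<in> M" for v
    using hk(3)[OF E_M[OF hk(2) that]] hk(4)[OF that] by simp
  then show ?case unfolding E_simps using E_comp_closed[OF hk(1,2)] by blast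
qed

lemma S_ring_D:
  assumes "s \<in> S_ring t n p r"
  shows "s \<in> carrier E" and "v \<in> M \<Longrightarrow> s (frob r v) = frob r (s v)"
proof -
  have "s \<in> carrier E \<and> (\<forall>v\<in>M. frob_end t n p r (s v) = s (frob_end t n p r v))"
  proof (rule generate_ring_commute[OF _ frob_end_closed])
    show "insert (frob_end t n p r) (kappa t n p) \<subseteq> carrier E"
      using kappa_closed frob_end_closed by simp
    show "frob_end t n p r (h v) = h (frob_end t n p r v)"
      if "h \<in> insert (frob_end t n p r) (kappa t n p)" "v \<in> M" for h v
      using that by (auto simp: kappa_def frob_end_def restrict0_def frob_M act_M act_frob)
  qed (use assms in \<open>simp add: S_ring_def\<close>)
  then show "s \<in> carrier E" "v \<in> M \<Longrightarrow> s (frob r v) = frob r (s v)"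
    by (auto simp: frob_end_def restrict0_def E_M)
qed

lemma R0_gens: "insert (frob_end t n p r [^]\<^bsub>E\<^esub> m) (kappa t n p) \<subseteq> carrier E"
  using kappa_closed frob_pow_closed by (simp add: frob_end_pow)

lemma R0_closed: "R0_ring t n p r m \<subseteq> carrier E"
proof
  fix g assume "g \<in> R0_ring t n p r m"
  then show "g \<in> carrier E"
    unfolding R0_ring_def
  proof (rule generate_ring_commute[OF R0_gens E_one_closed, THEN conjunct1, rotated])
    fix h v assume h: "h \<in> insert (frob_end t n p r [^]\<^bsub>E\<^esub> m) (kappa t n p)" and v: "v \<in> M"
    have "h \<in> carrier E" using h R0_gens by blast
    then show "restrict0 M (\<lambda>v. v) (h v) = h (restrict0 M (\<lambda>v. v) v)"
      using v by (simp add: restrict0_def E_M)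
  qed
qed

text \<open>
  Elements of \<open>E\<close> commute with \<open>\<kappa>\<close> by definition, so that only the second generator of \<open>R\<^sub>0 = \<kappa>[\<pi>\<^sup>m]\<close>
  imposes a condition.
\<close>
lemma R_ring_iff:
  "f \<in> R_ring t n p r m \<longleftrightarrow> f \<in> carrier E \<and> (\<forall>v\<in>M. f (frob (r * m) v) = frob (r * m) (f v))"
proof (intro iffI conjI)
  assume f: "f \<in> R_ring t n p r m"
  show fE: "f \<in> carrier E" using f by (simp add: R_ring_def)
  have "restrict0 M (frob (r * m)) \<in> R0_ring t n p r m"
    unfolding R0_ring_def frob_end_pow by (rule generate_ring.incl) simp
  then have "f \<circ> restrict0 M (frob (r * m)) = restrict0 M (frob (r * m)) \<circ> f"
    using f by (simp add: R_ring_def)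
  then have comm: "f (restrict0 M (frob (r * m)) v) = restrict0 M (frob (r * m)) (f v)" for v
    by (simp add: fun_eq_iff)
  show "\<forall>v\<in>M. f (frob (r * m) v) = frob (r * m) (f v)"
  proof
    fix v assume v: "v \<in> M"
    show "f (frob (r * m) v) = frob (r * m) (f v)"
      using comm[of v] by (simp add: restrict0_def v E_M[OF fE v])
  qed
next
  assume f: "f \<in> carrier E \<and> (\<forall>v\<in>M. f (frob (r * m) v) = frob (r * m) (f v))"
  then have fE: "f \<in> carrier E" by simp
  have "f \<circ> g = g \<circ> f" if g: "g \<in> R0_ring t n p r m" for g
  proof
    fix v
    have gE: "g \<in> carrier E" using g R0_closed by blast
    have comm: "f (h w) = h (f w)"
      if "h \<in> insert (frob_end t n p r [^]\<^bsub>E\<^esub> m) (kappa t n p)" "w \<in> M" for h w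
      using that f E_M[OF fE] E_act[OF fE] by (auto simp: kappa_def frob_end_pow restrict0_def)
    show "(f \<circ> g) v = (g \<circ> f) v"
    proof (cases "v \<in> M")
      case True
      then show ?thesis
        using generate_ring_commute[OF R0_gens fE comm g[unfolded R0_ring_def]] by simp
    next
      case False
      show ?thesis
        by (simp add: E_outside[OF fE False] E_outside[OF gE False] E_zero[OF fE] E_zero[OF gE])
    qed
  qed
  then show "f \<in> R_ring t n p r m" using fE by (simp add: R_ring_def)
qed

end

section \<open>Normal elements and the centralizer\<close>

locale drinfeld_normal = drinfeld_torsion +
  fixes \<alpha> :: "'a alg_closure"
  assumes normal: "S_normal t n p r \<alpha>"
begin

lemma \<alpha>_M: "\<alpha> \<in> M"
  using normal by (simp add: S_normal_def)

lemma orbit_M: "frob (r * i) \<alpha> \<in> M"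
  by (rule frob_mult_M[OF \<alpha>_M])

text \<open>
  The coordinates with respect to the normal basis run over \<open>\<kappa>\<^sup>n\<close>, and the polynomials of degree less
  than \<open>d\<close> represent \<open>\<kappa>\<close>.
\<close>
lemma card_M: "finite M \<and> card M = CARD('a) ^ (n * d)"
proof -
  let ?D = "{a :: 'a poly. Polynomial.degree a < d}"
  let ?E = "{..<n} \<rightarrow>\<^sub>E ?D"
  define comb where "comb c = (\<Sum>i<n. act (c i) (frob (r * i) \<alpha>))" for c
  have p0: "p \<noteq> 0" using p_degree by auto
  have indep: "(\<Sum>i<n. act (e i) (frob (r * i) \<alpha>)) = 0 \<Longrightarrow> \<forall>i<n. p dvd e i" for e
    using normal by (simp add: S_normal_def)
  have "bij_betw comb ?E M"
    unfolding bij_betw_def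
  proof (intro conjI inj_onI equalityI subsetI)
    fix c c' assume cc: "c \<in> ?E" "c' \<in> ?E" "comb c = comb c'"
    have "(\<Sum>i<n. act (c i - c' i) (frob (r * i) \<alpha>)) = 0"
      using cc(3) by (simp add: comb_def act_minus sum_subtractf)
    then have dvd: "\<forall>i<n. p dvd (c i - c' i)" by (rule indep)
    have "c i = c' i" if "i < n" for i
    proof (rule ccontr)
      assume ne: "c i \<noteq> c' i"
      have "Polynomial.degree (c i - c' i) < d"
        using cc(1,2) that by (intro degree_diff_less) auto
      moreover have "d \<le> Polynomial.degree (c i - c' i)"
        using dvd that ne dvd_imp_degree_le[of p "c i - c' i"] p_degree by simp
      ultimately show False by simp
    qed
    then show "c = c'" using cc by (intro PiE_ext) auto
  next
    fix v assume "v \<in> comb ` ?E"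
    then show "v \<in> M" unfolding comb_def by (auto intro!: sum_M act_M orbit_M)
  next
    fix v assume "v \<in> M"
    then obtain c where c: "v = comb c"
      using normal by (auto simp: S_normal_def comb_def)
    define c' where "c' = restrict (\<lambda>i. c i mod p) {..<n}"
    have "comb c' = v"
      unfolding c comb_def by (intro sum.cong) (auto simp: c'_def act_mod orbit_M)
    moreover have "Polynomial.degree (a mod p) < d" for a
      using degree_mod_less'[OF p0, of a] p_degree by (cases "a mod p = 0") auto
    then have "c' \<in> ?E" by (simp add: c'_def)
    ultimately show "v \<in> comb ` ?E" by blast
  qed
  moreover have "finite ?E" "card ?E = CARD('a) ^ (n * d)"
    using card_poly_degree_less[OF p_degree(2), where 'a = 'a]
    by (auto simp: card_PiE power_mult[symmetric] mult.commute intro!: finite_PiE)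
  ultimately show ?thesis using bij_betw_finite bij_betw_same_card by metis
qed

text \<open>
  An injective self-map of a finite set is surjective.
\<close>
lemma frob_surj_M:
  assumes "v \<in> M"
  obtains w where "w \<in> M" "v = frob r w"
proof -
  have "frob r ` M = M"
    using card_M frob_M inj_on_subset[OF inj_frob, of M] by (intro endo_inj_surj) auto
  then show ?thesis using assms that by blast
qed

lemma E_eq_0I:
  assumes f: "f \<in> carrier E" and zero: "\<And>i. i < n \<Longrightarrow> f (frob (r * i) \<alpha>) = 0"
  shows "f v = 0"
proof (cases "v \<in> M")
  case True
  then obtain c where c: "v = (\<Sum>i<n. act (c i) (frob (r * i) \<alpha>))"
    using normal by (auto simp: S_normal_def)
  have "f v = (\<Sum>i<n. f (act (c i) (frob (r * i) \<alpha>)))"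
    unfolding c by (rule E_sum[OF f]) (rule act_M[OF orbit_M])
  also have "\<dots> = 0"
    by (rule sum.neutral) (auto simp: E_act[OF f] orbit_M zero)
  finally show ?thesis .
qed (rule E_outside[OF f])

lemma R_frob:
  assumes f: "f \<in> R_ring t n p r m" and w: "w \<in> M"
  shows "f (frob (r * (m * k)) w) = frob (r * (m * k)) (f w)"
proof (induction k)
  case (Suc k)
  have eq: "frob (r * (m * Suc k)) x = frob (r * m) (frob (r * (m * k)) x)" for x :: "'a alg_closure"
    by (simp add: frob_frob distrib_left)
  show ?case unfolding eq
    using f frob_mult_M[OF w, of "m * k"] Suc by (simp add: R_ring_iff)
qed simp

text \<open>
  The first \<open>m\<close> conjugates of \<open>\<alpha>\<close> generate \<open>M\<close> over \<open>R\<^sub>0\<close>, because division with remainder by \<open>m\<close> writes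
  \<open>\<pi>\<^sup>i\<close> as a power of \<open>\<pi>\<^sup>m\<close> times one of \<open>1, \<pi>, \<dots>, \<pi>\<^bsup>m-1\<^esup>\<close>.
\<close>
lemma R_eq_0I:
  assumes f: "f \<in> R_ring t n p r m" and zero: "\<And>i. i < m \<Longrightarrow> f (frob (r * i) \<alpha>) = 0"
  shows "f v = 0"
proof (rule E_eq_0I[where f = f])
  show "f \<in> carrier E" using f by (simp add: R_ring_iff)
  fix i assume "i < n"
  have m: "m > 0" using m_dvd_n by (auto intro: Nat.gr0I)
  have "frob (r * i) \<alpha> = frob (r * (m * (i div m))) (frob (r * (i mod m)) \<alpha>)"
    by (simp add: frob_frob distrib_left[symmetric])
  then show "f (frob (r * i) \<alpha>) = 0"
    using R_frob[OF f orbit_M] zero[of "i mod m"] m by simp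
qed

text \<open>
  Elements of \<open>R\<close> are \<open>R\<^sub>0\<close>-linear, so they vanish on \<open>W\<^sub>\<delta>\<close> as soon as they vanish on its generators.
\<close>
lemma rank_BCH_iff:
  "f \<in> rank_BCH t n p r m \<alpha> \<delta> \<longleftrightarrow>
     f \<in> R_ring t n p r m \<and> (\<forall>i<\<delta> - 1. f (frob (r * i) \<alpha>) = 0)"
proof -
  let ?R0 = "R0_ring t n p r m" and ?one = "restrict0 M (\<lambda>v. v)"
  have one: "?one \<in> ?R0" using generate_ring.one[of E] by (simp add: R0_ring_def)
  have "\<ominus>\<^bsub>E\<^esub> ?one \<in> ?R0" using one by (simp add: R0_ring_def generate_ring.a_inv)
  then have "?one \<oplus>\<^bsub>E\<^esub> (\<ominus>\<^bsub>E\<^esub> ?one) \<in> ?R0"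
    using one unfolding R0_ring_def by (intro generate_ring.eng_add)
  (* Zero is needed to pick out a single generator of the sum. *)
  then have zero: "0 \<in> ?R0" by (simp add: E_a_inv E_one_closed)
  show ?thesis
  proof (intro iffI conjI allI impI)
    assume f: "f \<in> rank_BCH t n p r m \<alpha> \<delta>"
    then show "f \<in> R_ring t n p r m" by (simp add: rank_BCH_def Ann_def)
    fix k assume k: "k < \<delta> - 1"
    define g where "g = (\<lambda>i. if i = k then ?one else 0)"
    have "(\<Sum>i<\<delta> - 1. g i (frob (r * i) \<alpha>)) = (\<Sum>i<\<delta> - 1. if i = k then frob (r * k) \<alpha> else 0)"
      by (intro sum.cong) (auto simp: g_def restrict0_def orbit_M)
    also have "\<dots> = frob (r * k) \<alpha>" using k by simp
    finally have "frob (r * k) \<alpha> = (\<Sum>i<\<delta> - 1. g i (frob (r * i) \<alpha>))" ..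
    moreover have "\<forall>i<\<delta> - 1. g i \<in> ?R0" using one zero by (simp add: g_def)
    ultimately have "frob (r * k) \<alpha> \<in> W_space t n p r m \<alpha> \<delta>"
      unfolding W_space_def by blast
    then show "f (frob (r * k) \<alpha>) = 0" using f by (simp add: rank_BCH_def Ann_def)
  next
    assume "f \<in> R_ring t n p r m \<and> (\<forall>i<\<delta> - 1. f (frob (r * i) \<alpha>) = 0)"
    then have f: "f \<in> R_ring t n p r m" and z: "\<And>i. i < \<delta> - 1 \<Longrightarrow> f (frob (r * i) \<alpha>) = 0" by auto
    have fE: "f \<in> carrier E" using f by (simp add: R_ring_iff)
    have "f w = 0" if "w \<in> W_space t n p r m \<alpha> \<delta>" for w
    proof -
      from that obtain g where g: "\<And>i. i < \<delta> - 1 \<Longrightarrow> g i \<in> ?R0"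
        and w: "w = (\<Sum>i<\<delta> - 1. g i (frob (r * i) \<alpha>))" by (auto simp: W_space_def)
      have gE: "g i \<in> carrier E" if "i < \<delta> - 1" for i using g[OF that] R0_closed by blast
      have comm: "f (g i v) = g i (f v)" if "i < \<delta> - 1" for i v
        using f g[OF that] by (simp add: R_ring_def fun_eq_iff)
      have "f w = (\<Sum>i<\<delta> - 1. f (g i (frob (r * i) \<alpha>)))"
        unfolding w using gE by (intro E_sum[OF fE]) (simp add: E_range)
      also have "\<dots> = 0" using gE by (intro sum.neutral) (simp add: comm z E_zero)
      finally show ?thesis .
    qed
    then show "f \<in> rank_BCH t n p r m \<alpha> \<delta>" using f by (simp add: rank_BCH_def Ann_def)
  qed
qed

lemma R_zero: "(\<lambda>v. 0) \<in> R_ring t n p r m"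
  by (simp add: R_ring_iff E_carrier_iff)

lemma R_add: "f \<in> R_ring t n p r m \<Longrightarrow> g \<in> R_ring t n p r m \<Longrightarrow> (\<lambda>v. f v + g v) \<in> R_ring t n p r m"
  using E_add_closed[of f g] by (auto simp: R_ring_iff frob_add plus_fun_def)

lemma R_scale:
  assumes "z \<in> subfield_L m" "f \<in> R_ring t n p r m"
  shows "(\<lambda>v. z * f v) \<in> R_ring t n p r m"
  using assms frob_iterate_fixed[of m z r] E_scale_closed[of z f]
  by (simp add: R_ring_iff frob_mult subfield_L_def mult.commute[of m])

lemma R_sum:
  "finite I \<Longrightarrow> (\<And>i. i \<in> I \<Longrightarrow> f i \<in> R_ring t n p r m) \<Longrightarrow> (\<lambda>v. \<Sum>i\<in>I. f i v) \<in> R_ring t n p r m"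
  by (induction I rule: finite_induct) (simp_all add: R_zero R_add)

lemma S_frob_orbit:
  assumes "s \<in> S_ring t n p r" "v \<in> M"
  shows "s (frob (r * k) v) = frob (r * k) (s v)"
proof (induction k)
  case (Suc k)
  have eq: "frob (r * Suc k) x = frob r (frob (r * k) x)" for x :: "'a alg_closure"
    by (simp add: frob_frob)
  show ?case unfolding eq using S_ring_D(2)[OF assms(1) frob_mult_M[OF assms(2)]] Suc by simp
qed simp

lemma S_subset_R: "s \<in> S_ring t n p r \<Longrightarrow> s \<in> R_ring t n p r m"
  by (simp add: R_ring_iff S_ring_D(1) S_frob_orbit)

end

section \<open>Matrices of codewords\<close>

lemma is_basisD:
  assumes vs: "vector_space scale" and B: "is_basis scale N b V"
  shows "i < N \<Longrightarrow> b i \<in> V"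
    and "(\<Sum>i<N. scale (c i) (b i)) = 0 \<Longrightarrow> i < N \<Longrightarrow> c i = 0"
    and "v \<in> V \<Longrightarrow> \<exists>c. v = (\<Sum>i<N. scale (c i) (b i))"
proof -
  interpret vector_space scale by (rule vs)
  have inj: "inj_on b {..<N}" and ind: "independent (b ` {..<N})" and sp: "span (b ` {..<N}) = V"
    using B by (auto simp: is_basis_def)
  have reindex: "(\<Sum>x\<in>b ` {..<N}. scale (u x) x) = (\<Sum>i<N. scale (u (b i)) (b i))" for u
    using sum.reindex[OF inj, of "\<lambda>x. scale (u x) x"] by simp
  show "b i \<in> V" if "i < N"
    using span_base[of "b i" "b ` {..<N}"] that sp by auto
  show "c i = 0" if "(\<Sum>i<N. scale (c i) (b i)) = 0" "i < N"
  proof -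
    define u where "u x = c (the_inv_into {..<N} b x)" for x
    have u: "u (b i) = c i" if "i < N" for i
      using the_inv_into_f_f[OF inj] that by (simp add: u_def)
    have "(\<Sum>x\<in>b ` {..<N}. scale (u x) x) = 0"
      unfolding reindex using that(1) by (simp add: u)
    then have "u (b i) = 0"
      using that(2) independentD[OF ind, of "b ` {..<N}" u "b i"] by simp
    then show ?thesis using u that(2) by simp
  qed
  show "\<exists>c. v = (\<Sum>i<N. scale (c i) (b i))" if "v \<in> V"
  proof -
    from that obtain u where "v = (\<Sum>x\<in>b ` {..<N}. scale (u x) x)"
      unfolding sp[symmetric] span_finite[OF finite_imageI[OF finite_lessThan]] by blast
    then show ?thesis unfolding reindex by (rule exI[of _ "\<lambda>i. u (b i)"])
  qed
qed

text \<open>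
  The two bases enter through their coordinates. Linear independence of the \<open>s\<^sub>j\<close> is that of functions,
  hence the relation at all \<open>v\<close> in its hypothesis.
\<close>
locale drinfeld_code = drinfeld_normal +
  fixes lam :: "nat \<Rightarrow> 'a alg_closure" and s :: "nat \<Rightarrow> 'a alg_closure \<Rightarrow> 'a alg_closure"
  assumes lam_L: "i < m \<Longrightarrow> lam i \<in> subfield_L m"
    and lam_indep: "(\<Sum>i<m. to_ac (c i) * lam i) = 0 \<Longrightarrow> i < m \<Longrightarrow> c i = 0"
    and lam_span: "z \<in> subfield_L m \<Longrightarrow> \<exists>c. z = (\<Sum>i<m. to_ac (c i) * lam i)"
    and s_S: "j < n * d \<Longrightarrow> s j \<in> S_ring t n p r"
    and s_indep: "(\<And>v. (\<Sum>j<n * d. to_ac (c j) * s j v) = 0) \<Longrightarrow> j < n * d \<Longrightarrow> c j = 0"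
begin

text \<open>
  The \<open>j\<close>-th column of \<open>A\<close>, read as an element of \<open>L\<close>.
\<close>
definition col_L :: "'a mat \<Rightarrow> nat \<Rightarrow> 'a alg_closure" where
  "col_L A j = (\<Sum>i<m. to_ac (A $$ (i, j)) * lam i)"

text \<open>
  The element of \<open>R\<close> with matrix \<open>A\<close>, that is, the inverse of \<open>coord_mat\<close>.
\<close>
definition word :: "'a mat \<Rightarrow> 'a alg_closure \<Rightarrow> 'a alg_closure" where
  "word A = (\<lambda>v. \<Sum>j<n * d. col_L A j * s j v)"

abbreviation mats :: "'a mat set" where "mats \<equiv> carrier_mat m (n * d)"

abbreviation R :: "('a alg_closure \<Rightarrow> 'a alg_closure) set" where "R \<equiv> R_ring t n p r m"

lemma subfield_sum: "(\<And>i. i \<in> I \<Longrightarrow> f i \<in> subfield_L m) \<Longrightarrow> (\<Sum>i\<in>I. f i) \<in> subfield_L m"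
  by (simp add: subfield_L_def frob_sum)

lemma subfield_mult: "x \<in> subfield_L m \<Longrightarrow> y \<in> subfield_L m \<Longrightarrow> x * y \<in> subfield_L m"
  by (simp add: subfield_L_def frob_mult)

lemma subfield_to_ac: "to_ac c \<in> subfield_L m"
  by (simp add: subfield_L_def)

lemma col_L_L: "col_L A j \<in> subfield_L m"
  unfolding col_L_def by (intro subfield_sum subfield_mult subfield_to_ac lam_L) simp

lemma word_R: "word A \<in> R"
  unfolding word_def by (intro R_sum R_scale col_L_L S_subset_R s_S) simp_all

text \<open>
  Descent applies because \<open>\<sigma>\<close> maps relations to relations: at \<open>v = \<pi> w\<close>, the conjugate relation is \<open>\<pi>\<close>
  applied to the given relation at \<open>w\<close>.
\<close>
lemma S_independent_over_L:
  assumes L: "\<And>j. j < n * d \<Longrightarrow> b j \<in> subfield_L m"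
    and zero: "\<And>v. (\<Sum>j<n * d. b j * s j v) = 0" and j: "j < n * d"
  shows "b j = 0"
proof (rule galois_descent_independent[where s = s and N = "n * d" and b = b])
  show "coprime m r" by (rule coprime_m_r)
  show "c i = 0" if "\<And>v. (\<Sum>j<n * d. to_ac (c j) * s j v) = 0" "i < n * d" for c i
    using that by (rule s_indep)
  show "(\<Sum>j<n * d. frob r (e j) * s j v) = 0"
    if e: "\<And>v. (\<Sum>j<n * d. e j * s j v) = 0" for e v
  proof (cases "v \<in> M")
    case True
    then obtain w where w: "w \<in> M" "v = frob r w" by (rule frob_surj_M)
    have "(\<Sum>j<n * d. frob r (e j) * s j v) = frob r (\<Sum>j<n * d. e j * s j w)"
      unfolding frob_sum using w S_ring_D(2)[OF s_S] by (intro sum.cong) (auto simp: frob_mult)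
    then show ?thesis using e by simp
  next
    case False
    then show ?thesis using E_outside[OF S_ring_D(1)[OF s_S]] by (intro sum.neutral) auto
  qed
qed (use L zero j in auto)

lemma word_inj: "inj_on word mats"
proof (rule inj_onI)
  fix A B assume AB: "A \<in> mats" "B \<in> mats" "word A = word B"
  have zero: "(\<Sum>j<n * d. (col_L A j - col_L B j) * s j v) = 0" for v
    using fun_cong[OF AB(3), of v] by (simp add: word_def left_diff_distrib sum_subtractf)
  have L: "col_L A j - col_L B j \<in> subfield_L m" for j
    using col_L_L by (simp add: subfield_L_def frob_diff)
  have eq: "col_L A j - col_L B j = 0" if "j < n * d" for j
    by (rule S_independent_over_L[where b = "\<lambda>j. col_L A j - col_L B j", OF L zero that])
  have "A $$ (i, j) = B $$ (i, j)" if "i < m" "j < n * d" for i j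
  proof -
    have "(\<Sum>i<m. to_ac (A $$ (i, j) - B $$ (i, j)) * lam i) = 0"
      using eq[OF that(2)] by (simp add: col_L_def left_diff_distrib sum_subtractf)
    from lam_indep[OF this that(1)] show ?thesis by simp
  qed
  then show "A = B" using AB by (intro eq_matI) simp_all
qed

definition orbit_values :: "('a alg_closure \<Rightarrow> 'a alg_closure) \<Rightarrow> nat \<Rightarrow> 'a alg_closure" where
  "orbit_values f = restrict (\<lambda>i. f (frob (r * i) \<alpha>)) {..<m}"

lemma orbit_values_inj: "inj_on orbit_values R"
proof (rule inj_onI)
  fix f g assume fg: "f \<in> R" "g \<in> R" "orbit_values f = orbit_values g"
  let ?h = "\<lambda>v. f v + (-1) * g v"
  have h: "?h \<in> R" using fg by (intro R_add R_scale) (simp_all add: subfield_L_def frob_minus)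
  have "f v + (-1) * g v = 0" for v
  proof (rule R_eq_0I[OF h])
    show "f (frob (r * i) \<alpha>) + (-1) * g (frob (r * i) \<alpha>) = 0" if "i < m" for i
      using fun_cong[OF fg(3), of i] that by (simp add: orbit_values_def)
  qed
  then show "f = g" by (simp add: fun_eq_iff)
qed

text \<open>
  Both maps are injective and the sets at the two ends have the same finite cardinality. This shows at
  once that every element of \<open>R\<close> has a matrix and that the values at \<open>\<alpha>, \<pi>\<alpha>, \<dots>, \<pi>\<^bsup>m-1\<^esup>\<alpha>\<close> can be
  prescribed arbitrarily.
\<close>
lemma word_orbit_bij:
  "word ` mats = R" "orbit_values ` R = {..<m} \<rightarrow>\<^sub>E M"
proof -
  let ?P = "{..<m} \<rightarrow>\<^sub>E M"
  have finP: "finite ?P" using card_M by (intro finite_PiE) auto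
  have cardP: "card ?P = CARD('a) ^ (m * (n * d))"
    using card_M by (simp add: card_PiE power_mult[symmetric] mult.commute)
  have sub1: "word ` mats \<subseteq> R" using word_R by blast
  have sub2: "orbit_values ` R \<subseteq> ?P"
  proof (rule image_subsetI)
    fix f assume "f \<in> R"
    then have "f v \<in> M" for v by (simp add: R_ring_iff E_range)
    then show "orbit_values f \<in> ?P" unfolding orbit_values_def by (simp only: restrict_PiE_iff) blast
  qed
  have finR: "finite R" by (rule inj_on_finite[OF orbit_values_inj sub2 finP])
  have le1: "card mats \<le> card R" by (rule card_inj_on_le[OF word_inj sub1 finR])
  have le2: "card R \<le> card ?P" by (rule card_inj_on_le[OF orbit_values_inj sub2 finP])
  have eq: "card mats = card ?P" using cardP card_carrier_mat by metis
  show "word ` mats = R"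
    using le1 le2 eq by (intro card_subset_eq[OF finR sub1]) (simp add: card_image[OF word_inj])
  show "orbit_values ` R = ?P"
    using le1 le2 eq by (intro card_subset_eq[OF finP sub2]) (simp add: card_image[OF orbit_values_inj])
qed

lemma card_rank_BCH:
  assumes "1 \<le> \<delta>" "\<delta> \<le> m"
  shows "card (rank_BCH t n p r m \<alpha> \<delta>) = CARD('a) ^ (n * d * (m - \<delta> + 1))"
proof -
  let ?C = "rank_BCH t n p r m \<alpha> \<delta>"
  let ?Q = "PiE {..<m} (\<lambda>i. if i < \<delta> - 1 then {0} else M)"
  have CR: "?C \<subseteq> R" using rank_BCH_iff by blast
  have "orbit_values ` ?C = ?Q"
  proof (intro equalityI subsetI)
    fix y assume "y \<in> orbit_values ` ?C"
    then obtain f where f: "f \<in> R" "\<forall>i<\<delta> - 1. f (frob (r * i) \<alpha>) = 0" "y = orbit_values f"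
      using rank_BCH_iff by blast
    have "f v \<in> M" for v using f(1) E_range by (simp add: R_ring_iff)
    then show "y \<in> ?Q" unfolding f(3) orbit_values_def using f(2)
      by (simp add: restrict_PiE_iff)
  next
    fix y assume y: "y \<in> ?Q"
    then have "y \<in> {..<m} \<rightarrow>\<^sub>E M"
      by (rule subsetD[OF PiE_mono, rotated]) simp
    then obtain f where f: "f \<in> R" "y = orbit_values f" using word_orbit_bij(2) by blast
    have "f (frob (r * i) \<alpha>) = 0" if "i < \<delta> - 1" for i
    proof -
      have "y i = 0" using PiE_mem[OF y, of i] that assms by simp
      moreover have "i < m" using that assms by linarith
      ultimately show ?thesis by (simp add: f(2) orbit_values_def)
    qed
    then show "y \<in> orbit_values ` ?C" using f rank_BCH_iff by blast
  qed
  then have "card ?C = card ?Q"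
    using card_image[OF inj_on_subset[OF orbit_values_inj CR]] by simp
  also have "\<dots> = (\<Prod>i<m. if i < \<delta> - 1 then 1 else card M)"
    by (simp add: card_PiE if_distrib[of card] cong: if_cong)
  also have "\<dots> = (\<Prod>i\<in>{\<delta> - 1..<m}. card M)"
    by (intro prod.mono_neutral_cong_right) auto
  also have "\<dots> = (CARD('a) ^ (n * d)) ^ (m - \<delta> + 1)"
  proof -
    have "card {\<delta> - 1..<m} = m - \<delta> + 1" using assms by simp
    then show ?thesis using card_M by (simp only: prod_constant)
  qed
  also have "\<dots> = CARD('a) ^ (n * d * (m - \<delta> + 1))"
    by (simp only: power_mult)
  finally show ?thesis .
qed

lemma n_d_pos: "0 < n * d"
  using m_dvd_n p_degree by simp

lemma coord_mat_word:
  assumes "A \<in> mats"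
  shows "coord_mat m (n * d) lam s (word A) = A"
proof -
  have "coord_mat m (n * d) lam s f = (THE A. A \<in> mats \<and> f = word A)" for f
    by (simp only: coord_mat_def word_def col_L_def)
  moreover have "(THE B. B \<in> mats \<and> word A = word B) = A"
    using assms word_inj by (intro the_equality) (auto simp: inj_on_def)
  ultimately show ?thesis by simp
qed

section \<open>Dimension and minimum distance\<close>

definition code :: "nat \<Rightarrow> 'a mat set" where
  "code \<delta> = {A \<in> mats. word A \<in> rank_BCH t n p r m \<alpha> \<delta>}"

lemma word_image_code: "word ` code \<delta> = rank_BCH t n p r m \<alpha> \<delta>"
proof -
  have "rank_BCH t n p r m \<alpha> \<delta> \<subseteq> word ` mats"
    unfolding word_orbit_bij(1) using rank_BCH_iff by blast
  then show ?thesis unfolding code_def by blast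
qed

lemma coord_mat_image: "coord_mat m (n * d) lam s ` rank_BCH t n p r m \<alpha> \<delta> = code \<delta>"
proof -
  have "coord_mat m (n * d) lam s ` word ` code \<delta> = (\<lambda>A. A) ` code \<delta>"
    unfolding image_image by (intro image_cong refl coord_mat_word) (simp add: code_def)
  then show ?thesis by (simp add: word_image_code)
qed

lemma card_code:
  assumes "1 \<le> \<delta>" "\<delta> \<le> m"
  shows "card (code \<delta>) = CARD('a) ^ (n * d * (m - \<delta> + 1))"
proof -
  have "inj_on word (code \<delta>)" by (rule inj_on_subset[OF word_inj]) (auto simp: code_def)
  from card_image[OF this] show ?thesis by (simp add: word_image_code card_rank_BCH[OF assms])
qed

lemma finite_code: "finite (code \<delta>)"
proof (rule finite_subset)
  show "code \<delta> \<subseteq> mats" by (auto simp: code_def)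
  show "finite mats" using card_carrier_mat by blast
qed

lemma word_add: "A \<in> mats \<Longrightarrow> B \<in> mats \<Longrightarrow> word (A + B) = (\<lambda>v. word A v + word B v)"
  by (simp add: word_def col_L_def distrib_right sum.distrib fun_eq_iff)

lemma word_smult: "A \<in> mats \<Longrightarrow> word (c \<cdot>\<^sub>m A) = (\<lambda>v. to_ac c * word A v)"
  by (simp add: word_def col_L_def fun_eq_iff sum_distrib_left sum_distrib_right mult.assoc)

lemma word_zero: "word (0\<^sub>m m (n * d)) = (\<lambda>v. 0)"
  by (simp add: word_def col_L_def)

lemma rank_BCH_zero: "(\<lambda>v. 0) \<in> rank_BCH t n p r m \<alpha> \<delta>"
  by (simp add: rank_BCH_iff R_zero)

lemma rank_BCH_add:
  "f \<in> rank_BCH t n p r m \<alpha> \<delta> \<Longrightarrow> g \<in> rank_BCH t n p r m \<alpha> \<delta> \<Longrightarrow>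
    (\<lambda>v. f v + g v) \<in> rank_BCH t n p r m \<alpha> \<delta>"
  by (simp add: rank_BCH_iff R_add)

lemma rank_BCH_scale:
  "z \<in> subfield_L m \<Longrightarrow> f \<in> rank_BCH t n p r m \<alpha> \<delta> \<Longrightarrow>
    (\<lambda>v. z * f v) \<in> rank_BCH t n p r m \<alpha> \<delta>"
  by (simp add: rank_BCH_iff R_scale)

lemma code_zero: "0\<^sub>m m (n * d) \<in> code \<delta>"
  by (simp add: code_def word_zero rank_BCH_zero)

lemma code_add: "A \<in> code \<delta> \<Longrightarrow> B \<in> code \<delta> \<Longrightarrow> A + B \<in> code \<delta>"
  by (simp add: code_def word_add rank_BCH_add)

lemma code_smult: "A \<in> code \<delta> \<Longrightarrow> c \<cdot>\<^sub>m A \<in> code \<delta>"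
  by (simp add: code_def word_smult rank_BCH_scale subfield_to_ac)

lemma code_subspace: "VectorSpace.subspace class_ring (code \<delta>) (module_mat TYPE('a) m (n * d))"
  unfolding subspace_def submodule_def
  using code_zero code_add code_smult matrix_vs[where 'a = 'a, of m "n * d"]
  by (auto simp: module_mat_simps code_def vectorspace_def)

lemma mat_dim_code:
  assumes "1 \<le> \<delta>" "\<delta> \<le> m"
  shows "mat_dim m (n * d) (code \<delta>) = n * d * (m - \<delta> + 1)"
proof -
  let ?V = "(module_mat TYPE('a) m (n * d))\<lparr>carrier := code \<delta>\<rparr>"
  have "vectorspace class_ring ?V"
    by (rule vectorspace.subspace_is_vs[OF matrix_vs code_subspace])
  from card_eq_power_dim[OF this] have "card (code \<delta>) = CARD('a) ^ mat_dim m (n * d) (code \<delta>)"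
    using finite_code by (simp add: mat_dim_def)
  then show ?thesis
    using card_code[OF assms] card_field_gt_1[where 'a = 'a] by (simp only: power_inject_exp)
qed

lemma mult_mat_spec:
  assumes "z \<in> subfield_L m"
  shows "mult_mat m lam z \<in> carrier_mat m m \<and>
    (\<forall>k<m. z * lam k = (\<Sum>i<m. to_ac (mult_mat m lam z $$ (i, k)) * lam i))"
  unfolding mult_mat_def
proof (rule theI')
  have "\<forall>k<m. \<exists>c. z * lam k = (\<Sum>i<m. to_ac (c i) * lam i)"
    using lam_span subfield_mult[OF assms lam_L] by blast
  then obtain c where c: "\<And>k. k < m \<Longrightarrow> z * lam k = (\<Sum>i<m. to_ac (c k i) * lam i)" by metis
  show "\<exists>!B. B \<in> carrier_mat m m \<and> (\<forall>k<m. z * lam k = (\<Sum>i<m. to_ac (B $$ (i, k)) * lam i))"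
  proof (rule ex1I)
    show "mat m m (\<lambda>(i, k). c k i) \<in> carrier_mat m m \<and>
      (\<forall>k<m. z * lam k = (\<Sum>i<m. to_ac (mat m m (\<lambda>(i, k). c k i) $$ (i, k)) * lam i))"
      using c by simp
  next
    fix B assume B: "B \<in> carrier_mat m m \<and> (\<forall>k<m. z * lam k = (\<Sum>i<m. to_ac (B $$ (i, k)) * lam i))"
    have "B $$ (i, k) = c k i" if "i < m" "k < m" for i k
    proof -
      have "(\<Sum>i<m. to_ac (B $$ (i, k) - c k i) * lam i) = 0"
        using B c[OF that(2)] that(2) by (simp add: left_diff_distrib sum_subtractf)
      from lam_indep[OF this that(1)] show ?thesis by simp
    qed
    moreover have "dim_row B = m" "dim_col B = m" using B by auto
    ultimately show "B = mat m m (\<lambda>(i, k). c k i)" by (intro eq_matI) simp_all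
  qed
qed

lemma word_mult_mat:
  assumes z: "z \<in> subfield_L m" and A: "A \<in> mats"
  shows "word (mult_mat m lam z * A) = (\<lambda>v. z * word A v)"
proof -
  let ?B = "mult_mat m lam z"
  have B: "?B \<in> carrier_mat m m" and
    Bk: "\<And>k. k < m \<Longrightarrow> (\<Sum>i<m. to_ac (?B $$ (i, k)) * lam i) = z * lam k"
    using mult_mat_spec[OF z] by auto
  have "col_L (?B * A) j = z * col_L A j" if j: "j < n * d" for j
  proof -
    have "col_L (?B * A) j = (\<Sum>i<m. \<Sum>k<m. to_ac (?B $$ (i, k)) * lam i * to_ac (A $$ (k, j)))"
      using A B j by (simp add: col_L_def scalar_prod_def to_ac_sum sum_distrib_left
          sum_distrib_right atLeast0LessThan mult_ac)
    also have "\<dots> = (\<Sum>k<m. (\<Sum>i<m. to_ac (?B $$ (i, k)) * lam i) * to_ac (A $$ (k, j)))"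
      by (subst sum.swap) (simp add: sum_distrib_right)
    also have "\<dots> = (\<Sum>k<m. z * lam k * to_ac (A $$ (k, j)))"
      by (simp add: Bk)
    also have "\<dots> = z * col_L A j"
      by (simp add: col_L_def sum_distrib_left mult_ac)
    finally show ?thesis .
  qed
  then show ?thesis by (simp add: word_def sum_distrib_left mult.assoc)
qed

lemma code_Fqm_linear: "Fqm_linear m lam (code \<delta>)"
  unfolding Fqm_linear_def
proof (intro ballI)
  fix z :: "'a alg_closure" and A assume zA: "z \<in> subfield_L m" "A \<in> code \<delta>"
  then have A: "A \<in> mats" "word A \<in> rank_BCH t n p r m \<alpha> \<delta>" by (auto simp: code_def)
  have "mult_mat m lam z * A \<in> mats" 
    by (rule mult_carrier_mat[OF conjunct1[OF mult_mat_spec[OF zA(1)]] A(1)])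
  then show "mult_mat m lam z * A \<in> code \<delta>"
    using rank_BCH_scale[OF zA(1) A(2)] by (simp add: code_def word_mult_mat[OF zA(1) A(1)])
qed

text \<open>
  Here \<open>\<mu>\<close> turns the independent columns into elements of \<open>L\<close>, and \<open>u b\<close> is the value at \<open>\<alpha>\<close> of the
  coefficient of \<open>\<mu> b\<close> in \<open>S\<close>. The vanishing of the codeword at the first \<open>\<delta> - 1\<close> conjugates of \<open>\<alpha>\<close> is then a
  Moore system for the \<open>u b\<close>.
\<close>
lemma rank_code_ge:
  assumes A: "A \<in> code \<delta>" "A \<noteq> 0\<^sub>m m (n * d)"
  shows "\<delta> \<le> vec_space.rank m A"
proof (rule ccontr)
  assume "\<not> \<delta> \<le> vec_space.rank m A"
  then have small: "vec_space.rank m A \<le> \<delta> - 1" by simp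
  have Am: "A \<in> mats" and wA: "word A \<in> rank_BCH t n p r m \<alpha> \<delta>" using A by (auto simp: code_def)
  obtain B :: "'a vec set" and c where B: "finite B" "card B = vec_space.rank m A"
    and Ac: "\<And>i j. i < m \<Longrightarrow> j < n * d \<Longrightarrow> A $$ (i, j) = (\<Sum>b\<in>B. c b j * b $ i)"
    and ind: "\<And>e b. (\<And>i. i < m \<Longrightarrow> (\<Sum>b\<in>B. e b * b $ i) = 0) \<Longrightarrow> b \<in> B \<Longrightarrow> e b = 0"
    by (rule rank_factorisation[OF Am]) blast
  define \<mu> where "\<mu> b = (\<Sum>i<m. to_ac (b $ i) * lam i)" for b :: "'a vec"
  define u where "u b = (\<Sum>j<n * d. to_ac (c b j) * s j \<alpha>)" for b
  have comb: "(\<Sum>b\<in>B. to_ac (e b) * \<mu> b) = (\<Sum>i<m. to_ac (\<Sum>b\<in>B. e b * b $ i) * lam i)" for e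
  proof -
    have "(\<Sum>b\<in>B. to_ac (e b) * \<mu> b) = (\<Sum>b\<in>B. \<Sum>i<m. to_ac (e b * b $ i) * lam i)"
      by (simp add: \<mu>_def sum_distrib_left mult.assoc)
    also have "\<dots> = (\<Sum>i<m. \<Sum>b\<in>B. to_ac (e b * b $ i) * lam i)" by (rule sum.swap)
    finally show ?thesis by (simp add: to_ac_sum sum_distrib_right)
  qed
  have col: "col_L A j = (\<Sum>b\<in>B. to_ac (c b j) * \<mu> b)" if "j < n * d" for j
    unfolding comb col_L_def using that by (simp add: Ac)
  have value_eq: "word A (frob (r * k) \<alpha>) = (\<Sum>b\<in>B. \<mu> b * frob (r * k) (u b))" for k
  proof -
    have "word A (frob (r * k) \<alpha>)
        = (\<Sum>j<n * d. \<Sum>b\<in>B. to_ac (c b j) * \<mu> b * frob (r * k) (s j \<alpha>))"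
      by (simp add: word_def col S_frob_orbit[OF s_S \<alpha>_M] sum_distrib_right)
    also have "\<dots> = (\<Sum>b\<in>B. \<Sum>j<n * d. to_ac (c b j) * \<mu> b * frob (r * k) (s j \<alpha>))"
      by (rule sum.swap)
    also have "\<dots> = (\<Sum>b\<in>B. \<mu> b * frob (r * k) (u b))"
      by (simp add: u_def frob_sum frob_mult sum_distrib_left mult_ac)
    finally show ?thesis .
  qed
  have u0: "u b = 0" if "b \<in> B" for b
  proof (rule moore_independent[where I = B and \<mu> = \<mu> and v = u, OF coprime_m_r B(1) _ _ _ that])
    show "\<mu> b \<in> subfield_L m" for b
      unfolding \<mu>_def by (intro subfield_sum subfield_mult subfield_to_ac lam_L) simp
    show "e b = 0" if "(\<Sum>b\<in>B. to_ac (e b) * \<mu> b) = 0" "b \<in> B" for e b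
    proof (rule ind[OF _ that(2)])
      show "(\<Sum>b\<in>B. e b * b $ i) = 0" if "i < m" for i
        using lam_indep[of "\<lambda>i. \<Sum>b\<in>B. e b * b $ i", OF _ that] \<open>(\<Sum>b\<in>B. to_ac (e b) * \<mu> b) = 0\<close>
        unfolding comb by blast
    qed
    show "(\<Sum>b\<in>B. \<mu> b * frob (r * k) (u b)) = 0" if "k < card B" for k
      using wA that small B(2) unfolding rank_BCH_iff value_eq[symmetric] by auto
  qed
  have "word A v = 0" for v
    by (rule R_eq_0I[OF word_R]) (simp add: value_eq u0)
  then have "word A = word (0\<^sub>m m (n * d))" by (simp add: word_zero fun_eq_iff)
  then have "A = 0\<^sub>m m (n * d)" using word_inj Am by (simp add: inj_on_def)
  with A(2) show False by simp
qed

text \<open>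
  The pigeonhole proof of the Singleton bound: two distinct codewords agree in the last \<open>m - \<delta>\<close> rows,
  and their difference has only \<open>\<delta>\<close> nonzero rows.
\<close>
lemma exists_code_rank_le:
  assumes \<delta>: "1 \<le> \<delta>" "\<delta> \<le> m"
  obtains A where "A \<in> code \<delta>" "A \<noteq> 0\<^sub>m m (n * d)" "vec_space.rank m A \<le> \<delta>"
proof -
  let ?h = "\<lambda>A :: 'a mat. mat (m - \<delta>) (n * d) (\<lambda>(i, j). A $$ (i + \<delta>, j))"
  let ?T = "carrier_mat (m - \<delta>) (n * d) :: 'a mat set"
  have "card ?T = CARD('a) ^ ((m - \<delta>) * (n * d))" using card_carrier_mat by blast
  also have "\<dots> < CARD('a) ^ (n * d * (m - \<delta> + 1))"
    using n_d_pos card_field_gt_1[where 'a = 'a] by (intro power_strict_increasing) simp_all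
  also have "\<dots> = card (code \<delta>)" by (simp only: card_code[OF \<delta>])
  finally have less: "card ?T < card (code \<delta>)" .
  have finT: "finite ?T" using card_carrier_mat by blast
  have "\<not> inj_on ?h (code \<delta>)"
  proof
    assume "inj_on ?h (code \<delta>)"
    then have "card (code \<delta>) \<le> card ?T" by (rule card_inj_on_le[OF _ _ finT]) auto
    with less show False by simp
  qed
  then obtain A B where AB: "A \<in> code \<delta>" "B \<in> code \<delta>" "?h A = ?h B" "A \<noteq> B"
    unfolding inj_on_def by blast
  then have mats: "A \<in> mats" "B \<in> mats" by (auto simp: code_def)
  let ?D = "A + (-1) \<cdot>\<^sub>m B"
  have D: "?D \<in> code \<delta>" using AB code_add code_smult by blast
  have "?D \<noteq> 0\<^sub>m m (n * d)"
  proof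
    assume eq: "?D = 0\<^sub>m m (n * d)"
    have "A $$ (i, j) = B $$ (i, j)" if "i < m" "j < n * d" for i j
      using arg_cong[OF eq, of "\<lambda>Y. Y $$ (i, j)"] that mats by simp
    then have "A = B" using mats by (intro eq_matI) simp_all
    with AB(4) show False by simp
  qed
  moreover have "vec_space.rank m ?D \<le> \<delta>"
  proof (rule rank_le_nonzero_rows[OF _ \<delta>(2)])
    show "?D \<in> mats" using mats by simp
    fix i j assume ij: "\<delta> \<le> i" "i < m" "j < n * d"
    have "A $$ (i, j) = B $$ (i, j)"
      using arg_cong[OF AB(3), of "\<lambda>Y. Y $$ (i - \<delta>, j)"] ij by simp
    then show "?D $$ (i, j) = 0" using ij mats by simp
  qed
  ultimately show ?thesis using D that by blast
qed

lemma d_R_code: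
  assumes \<delta>: "1 \<le> \<delta>" "\<delta> \<le> m"
  shows "d_R m (n * d) (code \<delta>) = \<delta>"
proof -
  obtain A where A: "A \<in> code \<delta>" "A \<noteq> 0\<^sub>m m (n * d)" "vec_space.rank m A \<le> \<delta>"
    using exists_code_rank_le[OF \<delta>] .
  let ?S = "{vec_space.rank m A | A. A \<in> code \<delta> \<and> A \<noteq> 0\<^sub>m m (n * d)}"
  have "?S \<subseteq> vec_space.rank m ` code \<delta>" by blast
  then have "finite ?S" using finite_code finite_surj by blast
  moreover have "\<delta> \<le> k" if "k \<in> ?S" for k using that rank_code_ge by blast
  moreover have "\<delta> \<in> ?S" using A rank_code_ge[OF A(1,2)] le_antisym by blast
  ultimately show ?thesis unfolding d_R_def by (rule Min_eqI)
qed

lemma code_is_MRD: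
  assumes \<delta>: "1 \<le> \<delta>" "\<delta> \<le> m"
  shows "is_MRD m (n * d) (code \<delta>)"
proof -
  obtain A where A: "A \<in> code \<delta>" "A \<noteq> 0\<^sub>m m (n * d)"
    using exists_code_rank_le[OF \<delta>] .
  have "m \<le> n" using m_dvd_n by (simp add: dvd_imp_le)
  also have "n \<le> n * d" using p_degree(2) by simp
  finally have "m \<le> n * d" .
  moreover have "int (mat_dim m (n * d) (code \<delta>)) = int (n * d) * (int m - int (d_R m (n * d) (code \<delta>)) + 1)"
    using \<delta> by (simp only: mat_dim_code[OF \<delta>] d_R_code[OF \<delta>] of_nat_mult of_nat_add of_nat_diff of_nat_1)
  ultimately show ?thesis using A code_subspace by (auto simp: is_MRD_def Fq_linear_def)
qed

end

theorem theorem6p2: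
  fixes p0 p :: "'a::finite_field poly"
    and t \<alpha> :: "'a alg_closure"
    and n r d m \<delta> :: nat
    and lam :: "nat \<Rightarrow> 'a alg_closure"
    and s :: "nat \<Rightarrow> 'a alg_closure \<Rightarrow> 'a alg_closure"
    and C :: "('a alg_closure \<Rightarrow> 'a alg_closure) set"
    and AC :: "'a mat set"
  assumes "n \<ge> 1"
    and "lead_coeff p0 = 1" and "Factorial_Ring.irreducible p0" and "Polynomial.degree p0 = r"
    and "coprime n r"
    and "poly (map_poly to_ac p0) t = 0"
    and "m dvd n"
    and "lead_coeff p = 1" and "Factorial_Ring.irreducible p" and "Polynomial.degree p = d"
    and "p \<noteq> p0"
    and "is_basis scale_ac m lam (subfield_L m)"
    and "is_basis scale_fun (n * d) s (S_ring t n p r)"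
    and "S_normal t n p r \<alpha>"
    and "1 \<le> \<delta>" and "\<delta> \<le> m"
    and "C = rank_BCH t n p r m \<alpha> \<delta>"
    and "AC = coord_mat m (n * d) lam s ` C"
  shows "AC \<subseteq> carrier_mat m (n * d) \<and> Fqm_linear m lam AC \<and> is_MRD m (n * d) AC \<and>
         mat_dim m (n * d) AC = n * d * (m - \<delta> + 1) \<and> d_R m (n * d) AC = \<delta>"
proof -
  have fun_sum: "(\<Sum>j<N. scale_fun (c j) (s j)) v = (\<Sum>j<N. to_ac (c j) * s j v)" for N c v
    by (induction N) (simp_all add: scale_fun_def)
  note lam = is_basisD[OF vector_space_scale_ac \<open>is_basis scale_ac m lam (subfield_L m)\<close>,
      unfolded scale_ac_def]
  note s = is_basisD[OF vector_space_scale_fun \<open>is_basis scale_fun (n * d) s (S_ring t n p r)\<close>]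
  have "0 < d"
    using \<open>Factorial_Ring.irreducible p\<close> \<open>Polynomial.degree p = d\<close>
    by (auto simp: Factorial_Ring.irreducible_def is_unit_iff_degree)
  have "coprime m r"
    using \<open>coprime n r\<close> \<open>m dvd n\<close> by (meson coprime_divisors dvd_refl)
  interpret drinfeld_code t p n r d m \<alpha> lam s
  proof
    show "frob r t = t" using frob_root assms(3,4,6) by blast
    show "c j = 0" if "\<And>v. (\<Sum>j<n * d. to_ac (c j) * s j v) = 0" "j < n * d" for c j
      using that by (intro s(2)[of c j]) (simp_all add: fun_eq_iff fun_sum)
  qed (use assms \<open>0 < d\<close> \<open>coprime m r\<close> lam s in simp_all)
  have "AC = code \<delta>" by (simp only: assms(17,18) coord_mat_image)
  then show ?thesis
    using code_Fqm_linear code_is_MRD mat_dim_code d_R_code assms(15,16) by (auto simp: code_def)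
qed

end
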